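(* Consider a JSM-3 signal ensemble $x_j=z_C+z_j\in\mathbb{R}^N$, $j\in\{1,2,\dots,J\}$, with an arbitrary (not necessarily sparse) common component $z_C$ and sparse innovations $z_j$ of sparsity $K_j$. Assume that the nonzero expansion coefficients of the sparse innovations $z_j$ are i.i.d. Gaussian random variables and that their locations are uniformly distributed on $\{1,2,\dots,N\}$. Let the measurement matrices $\Phi_j$ (of size $M_j\times N$) contain i.i.d. $\mathcal{N}(0,\sigma_j^2)$ entries with $M_j\ge K_j+1$, and let $y_j=\Phi_jx_j$ be the measurements. Then each signal $x_j$ can be recovered using the TECC algorithm with probability approaching one as $J\to\infty$.
   Context: JSM-3 is the joint sparsity model of a nonsparse common component plus sparse innovations: each signal of the ensemble is $x_j=z_C+z_j$, where $z_C\in\mathbb{R}^N$ is an arbitrary vector common to all signals and each innovation $z_j\in\mathbb{R}^N$ has $K_j<N$ nonzero entries (sparsity is taken, without loss of generality, in the canonical basis of $\mathbb{R}^N$). Each signal is measured separately by its own matrix $\Phi_j$, and recovery is performed jointly from all of the $y_j$. TECC algorithm (Transpose Estimation of Common Component): 1. Estimate the common component: let $\widehat\Phi_j=\frac{1}{M_j\sigma_j^2}\Phi_j$, let $\widehat\Phi=[\widehat\Phi_1^T,\widehat\Phi_2^T,\dots,\widehat\Phi_J^T]^T$ be their vertical concatenation, and let $Y=[y_1^T,\dots,y_J^T]^T$. Set $\widehat z_C=\frac1J\widehat\Phi^TY=\frac1J\sum_{j=1}^J\frac{1}{M_j\sigma_j^2}\Phi_j^Ty_j$. 2. Estimate the measurements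 generated by the innovations: $\widehat y_j=y_j-\Phi_j\widehat z_C$ for each $j$. 3. Recover the innovations: using a standard single-signal compressive sensing recovery algorithm, obtain estimates $\widehat z_j$ of the innovations from $\widehat y_j$. (For tractable analysis of the algorithm, the proof of the theorem employs here a least-squares variant of $\ell_0$-norm minimization, i.e., a combinatorial search over the candidate supports $\Omega'\subseteq\{1,\dots,N\}$ of the given sparsity, comparing the distances from $\widehat y_j$ to the column spans of the submatrices of $\Phi_j$ with columns indexed by $\Omega'$.) 4. Obtain signal estimates: $\widehat x_j=\widehat z_C+\widehat z_j$.
   Formalization: The i.i.d. Gaussian innovation coefficients are taken to have mean zero (otherwise the common-component estimate is biased and recovery fails), and "recovered" means the correct support together with an estimate within any fixed ε > 0 of the signal. *)

theory Defs
  imports "HOL-Probability.Probability"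
begin

(* A measurement matrix with m rows is represented by its rows A 0, ..., A (m - 1), so that
   (A v)_i = A i \<bullet> v and A^T y = (\<Sum>i<m. y i *\<^sub>R A i). Measurement vectors are functions of the
   row index; only their values at i < m matter. *)

definition support :: "real^'n \<Rightarrow> 'n set" where
  "support v = {n. v $ n \<noteq> 0}"

definition residual_norm :: "nat \<Rightarrow> (nat \<Rightarrow> real^'n) \<Rightarrow> (nat \<Rightarrow> real) \<Rightarrow> real^'n \<Rightarrow> real" where
  "residual_norm m A y v = L2_set (\<lambda>i. y i - A i \<bullet> v) {..<m}"

(* Distance from y to the span of the columns of A indexed by \<Omega>. *)
definition column_span_dist :: "nat \<Rightarrow> (nat \<Rightarrow> real^'n) \<Rightarrow> (nat \<Rightarrow> real) \<Rightarrow> 'n set \<Rightarrow> real" where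
  "column_span_dist m A y \<Omega> = (INF v\<in>{v. support v \<subseteq> \<Omega>}. residual_norm m A y v)"

(* Least-squares l0 recovery: \<Omega> is a closest candidate support of size k, and v is a
   least-squares fit supported on it. This is a relation, since neither minimizer is unique
   in general. *)
definition ls_l0_solution ::
  "nat \<Rightarrow> (nat \<Rightarrow> real^'n) \<Rightarrow> (nat \<Rightarrow> real) \<Rightarrow> nat \<Rightarrow> 'n set \<Rightarrow> real^'n \<Rightarrow> bool" where
  "ls_l0_solution m A y k \<Omega> v \<longleftrightarrow>
     is_arg_min (column_span_dist m A y) (\<lambda>T. card T = k) \<Omega> \<and>
     is_arg_min (residual_norm m A y) (\<lambda>u. support u \<subseteq> \<Omega>) v"

definition tecc_common ::
  "(nat \<Rightarrow> nat) \<Rightarrow> (nat \<Rightarrow> real) \<Rightarrow> (nat \<Rightarrow> nat \<Rightarrow> real^'n) \<Rightarrow> (nat \<Rightarrow> nat \<Rightarrow> real) \<Rightarrow> nat \<Rightarrow> real^'n" where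
  "tecc_common M \<sigma> \<Phi> y J =
     (1 / real J) *\<^sub>R (\<Sum>j<J. (1 / (real (M j) * (\<sigma> j)\<^sup>2)) *\<^sub>R (\<Sum>i<M j. y j i *\<^sub>R \<Phi> j i))"

(* \<Omega> and xhat are a possible support estimate and signal estimate for signal j, computed by TECC
   jointly from the measurements of the signals 0, ..., J - 1 (relevant for j < J). *)
definition tecc_output ::
  "(nat \<Rightarrow> nat) \<Rightarrow> (nat \<Rightarrow> nat) \<Rightarrow> (nat \<Rightarrow> real) \<Rightarrow> (nat \<Rightarrow> nat \<Rightarrow> real^'n) \<Rightarrow> (nat \<Rightarrow> nat \<Rightarrow> real)
     \<Rightarrow> nat \<Rightarrow> nat \<Rightarrow> 'n set \<Rightarrow> real^'n \<Rightarrow> bool" where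
  "tecc_output K M \<sigma> \<Phi> y J j \<Omega> xhat \<longleftrightarrow>
     (let zc = tecc_common M \<sigma> \<Phi> y J;
          yhat = (\<lambda>i. y j i - \<Phi> j i \<bullet> zc)
      in \<exists>v. ls_l0_solution (M j) (\<Phi> j) yhat (K j) \<Omega> v \<and> xhat = zc + v)"

(* Law of a vector whose k possibly nonzero positions form a uniformly distributed k-element
   subset S and whose coefficients on S are, given S, i.i.d. N(0, \<tau>^2). *)
definition innovation_law :: "nat \<Rightarrow> real \<Rightarrow> (real^'n) measure" where
  "innovation_law k \<tau> =
     measure_pmf (pmf_of_set {S :: 'n set. card S = k}) \<bind>
       (\<lambda>S. distr (\<Pi>\<^sub>M n\<in>S. density lborel (normal_density 0 \<tau>)) borel
              (\<lambda>g. \<chi> n. if n \<in> S then g n else 0))"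

lemma innovation_law_kernel:
  assumes "\<tau> > 0"
  shows "(\<lambda>S. distr (\<Pi>\<^sub>M n\<in>S. density lborel (normal_density 0 \<tau>)) borel
            (\<lambda>g. \<chi> n. if n \<in> S then g n else 0))
          \<in> measurable (measure_pmf p) (prob_algebra (borel :: (real^'n) measure))"
proof -
  interpret N: prob_space "density lborel (normal_density 0 \<tau>)"
    using assms by (rule prob_space_normal_density)
  have "prob_space (distr (\<Pi>\<^sub>M n\<in>S. density lborel (normal_density 0 \<tau>)) borel
          (\<lambda>g. (\<chi> n. if n \<in> S then g n else 0) :: real^'n))" for S :: "'n set"
  proof (rule prob_space.prob_space_distr)
    show "prob_space (\<Pi>\<^sub>M n\<in>S. density lborel (normal_density 0 \<tau>))"
      by (intro prob_space_PiM N.prob_space_axioms)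
    show "(\<lambda>g. (\<chi> n. if n \<in> S then g n else 0) :: real^'n)
            \<in> borel_measurable (\<Pi>\<^sub>M n\<in>S. density lborel (normal_density 0 \<tau>))"
    proof (subst borel_measurable_euclidean_space, safe)
      fix b :: "real^'n" assume "b \<in> Basis"
      then obtain k where b: "b = axis k 1" by (auto simp: Basis_vec_def)
      show "(\<lambda>g. (\<chi> n. if n \<in> S then g n else 0) \<bullet> b)
              \<in> borel_measurable (\<Pi>\<^sub>M n\<in>S. density lborel (normal_density 0 \<tau>))"
        unfolding b inner_axis by (cases "k \<in> S") (simp_all, measurable)
    qed
  qed
  thus ?thesis by (auto simp: space_prob_algebra)
qed

lemma prob_space_innovation_law:
  assumes "\<tau> > 0"
  shows "prob_space (innovation_law k \<tau> :: (real^'n) measure)"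
    and "sets (innovation_law k \<tau> :: (real^'n) measure) = sets borel"
proof -
  show "prob_space (innovation_law k \<tau> :: (real^'n) measure)"
    unfolding innovation_law_def
    by (rule prob_space.prob_space_bind[OF prob_space_measure_pmf _
          measurable_prob_algebraD[OF innovation_law_kernel[OF assms]]])
       (use measurable_space[OF innovation_law_kernel[OF assms]] in
          \<open>auto simp: space_prob_algebra intro!: AE_I2\<close>)
  show "sets (innovation_law k \<tau> :: (real^'n) measure) = sets borel"
    unfolding innovation_law_def by (rule sets_bind) auto
qed

(* Minimizers always exist, so a statement about all TECC outputs is never vacuous. *)

lemma least_squares_exists:
  fixes A :: "nat \<Rightarrow> real^'n"
  shows "\<exists>v. is_arg_min (residual_norm m A y) (\<lambda>u. support u \<subseteq> \<Omega>) v"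
proof -
  define p where "p u = (\<chi> n. if n \<in> \<Omega> then u $ n else 0)" for u :: "real^'n"
  define a where "a i = p (A i)" for i
  define b where "b = (\<Sum>i<m. y i *\<^sub>R a i)"
  define G where "G v = (\<Sum>i<m. (a i \<bullet> v) *\<^sub>R a i)" for v
  have pA: "A i \<bullet> p u = a i \<bullet> u" for i u
    unfolding a_def p_def inner_vec_def by (intro sum.cong) auto
  have pid: "p u = u" if "support u \<subseteq> \<Omega>" for u
    using that by (auto simp: p_def vec_eq_iff support_def)
  have linG: "linear G"
    unfolding G_def by (intro linearI) (simp_all add: inner_add_right scaleR_add_left sum.distrib scaleR_sum_right)
  have sym: "G v \<bullet> w = v \<bullet> G w" for v w
    unfolding G_def inner_sum_left inner_sum_right by (intro sum.cong) (simp_all add: inner_commute)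
  have adj: "adjoint G = G"
    by (rule adjoint_unique) (simp add: sym)
  have kerb: "b \<bullet> w = 0" if "G w = 0" for w
  proof -
    have "(\<Sum>i<m. (a i \<bullet> w)\<^sup>2) = G w \<bullet> w"
      unfolding G_def inner_sum_left by (simp add: power2_eq_square)
    hence "\<forall>i<m. a i \<bullet> w = 0" using that by (simp add: sum_nonneg_eq_0_iff)
    thus ?thesis unfolding b_def inner_sum_left by simp
  qed
  have "b \<in> orthogonal_comp (G -` {0})"
    using kerb by (auto simp: orthogonal_comp_def orthogonal_def inner_commute)
  also have "G -` {0} = orthogonal_comp (range G)"
    using ker_orthogonal_comp_adjoint[OF linG] adj by simp
  also have "orthogonal_comp (orthogonal_comp (range G)) = range G"
    by (intro orthogonal_comp_self linear_subspace_image linG subspace_UNIV)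
  finally obtain v where v: "G v = b" by auto
  have "residual_norm m A y (p v) \<le> residual_norm m A y u" if "support u \<subseteq> \<Omega>" for u
  proof -
    define r where "r i = y i - a i \<bullet> v" for i
    have "(\<Sum>i<m. r i *\<^sub>R a i) = b - G v"
      unfolding r_def b_def G_def by (simp add: scaleR_diff_left sum_subtractf)
    hence "(\<Sum>i<m. r i *\<^sub>R a i) \<bullet> (v - u) = 0" using v by simp
    hence ort: "(\<Sum>i<m. r i * (a i \<bullet> (v - u))) = 0" by (simp add: inner_sum_left)
    have "(\<Sum>i<m. (y i - A i \<bullet> u)\<^sup>2) = (\<Sum>i<m. (r i)\<^sup>2 + 2 * (r i * (a i \<bullet> (v - u))) + (a i \<bullet> (v - u))\<^sup>2)"
    proof (intro sum.cong refl)
      fix i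
      have "A i \<bullet> u = a i \<bullet> u" using pA[of i u] pid[OF that] by simp
      thus "(y i - A i \<bullet> u)\<^sup>2 = (r i)\<^sup>2 + 2 * (r i * (a i \<bullet> (v - u))) + (a i \<bullet> (v - u))\<^sup>2"
        unfolding r_def inner_diff_right by (simp add: power2_eq_square algebra_simps)
    qed
    also have "\<dots> = (\<Sum>i<m. (r i)\<^sup>2) + 2 * (\<Sum>i<m. r i * (a i \<bullet> (v - u))) + (\<Sum>i<m. (a i \<bullet> (v - u))\<^sup>2)"
      by (simp add: sum.distrib sum_distrib_left)
    also have "\<dots> \<ge> (\<Sum>i<m. (r i)\<^sup>2)" using ort by (simp add: sum_nonneg)
    finally show ?thesis
      unfolding residual_norm_def L2_set_def r_def pA by simp
  qed
  moreover have "support (p v) \<subseteq> \<Omega>" by (auto simp: support_def p_def)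
  ultimately show ?thesis by (auto simp: is_arg_min_linorder)
qed

lemma tecc_output_exists:
  fixes \<Phi> :: "nat \<Rightarrow> nat \<Rightarrow> real^'n"
  assumes "K j \<le> CARD('n)"
  shows "\<exists>\<Omega> xhat. tecc_output K M \<sigma> \<Phi> y J j \<Omega> xhat"
proof -
  let ?f = "column_span_dist (M j) (\<Phi> j) (\<lambda>i. y j i - \<Phi> j i \<bullet> tecc_common M \<sigma> \<Phi> y J)"
  obtain T where "T \<subseteq> (UNIV :: 'n set)" "card T = K j"
    using obtain_subset_with_card_n[OF assms] by blast
  hence "{T :: 'n set. card T = K j} \<noteq> {}" by auto
  hence "\<exists>\<Omega>. is_arg_min ?f (\<lambda>T. T \<in> {T. card T = K j}) \<Omega>"
    by (intro ex_is_arg_min_if_finite) auto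
  then obtain \<Omega> where "is_arg_min ?f (\<lambda>T. card T = K j) \<Omega>" by auto
  with least_squares_exists show ?thesis
    unfolding tecc_output_def ls_l0_solution_def Let_def by blast
qed

end

theory Submission
  imports Defs
begin

text \<open>
  With \<open>x\<^sub>l = zC + z\<^sub>l\<close>, the matrix \<open>\<Phi>\<^sub>l\<^sup>T \<Phi>\<^sub>l / (M\<^sub>l \<sigma>\<^sub>l\<^sup>2)\<close> has mean \<open>1\<close> and is independent of \<open>z\<^sub>l\<close>, which has
  mean \<open>0\<close>. Hence the vectors \<open>\<Phi>\<^sub>l\<^sup>T \<Phi>\<^sub>l x\<^sub>l / (M\<^sub>l \<sigma>\<^sub>l\<^sup>2)\<close> are independent with mean \<open>zC\<close>, and their second moments
  are bounded uniformly in \<open>l\<close>, \<open>M\<^sub>l\<close> and \<open>\<sigma>\<^sub>l\<close>; by the weak law of large numbers their averages, which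
  are the estimates of the common component, tend to \<open>zC\<close> in mean square.

  For the fixed signal \<open>j\<close> this makes the innovation measurements \<open>\<Phi>\<^sub>j z\<^sub>j\<close> known up to a vanishing
  perturbation. Almost surely \<open>\<Phi>\<^sub>j\<close>, having at least \<open>K\<^sub>j + 1\<close> Gaussian rows, is injective on the vectors
  supported on the support of \<open>z\<^sub>j\<close> and on the \<open>K\<^sub>j + 1\<close> dimensional spaces spanned by \<open>z\<^sub>j\<close> and the vectors
  with any other candidate support, so \<open>\<Phi>\<^sub>j z\<^sub>j\<close> has positive distance from all wrong column spans. Hence
  small perturbations leave the support estimate correct and move the fit only slightly.
\<close>

section \<open>Measurability of infima over separable sets\<close>

text \<open>An infimum over an uncountable set need not be measurable. Continuity in
  \<open>v\<close> allows it to be taken over a countable dense subset of \<open>S\<close> instead;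
  boundedness below makes the real infima meaningful.\<close>

lemma borel_measurable_INF_continuous:
  fixes f :: "'a \<Rightarrow> 'b :: {metric_space, second_countable_topology} \<Rightarrow> real"
  assumes meas: "\<And>v. v \<in> S \<Longrightarrow> (\<lambda>\<omega>. f \<omega> v) \<in> borel_measurable M"
    and cont: "\<And>\<omega>. \<omega> \<in> space M \<Longrightarrow> continuous_on S (f \<omega>)"
    and bdd: "\<And>\<omega>. \<omega> \<in> space M \<Longrightarrow> bdd_below (f \<omega> ` S)"
    and ne: "S \<noteq> {}"
  shows "(\<lambda>\<omega>. INF v\<in>S. f \<omega> v) \<in> borel_measurable M"
proof -
  obtain T where T: "countable T" "T \<subseteq> S" "S \<subseteq> closure T"
    using separable by blast
  have T_ne: "T \<noteq> {}" using T(3) ne by auto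
  have "(INF v\<in>S. f \<omega> v) = (INF v\<in>T. f \<omega> v)" if \<omega>: "\<omega> \<in> space M" for \<omega>
  proof (rule antisym)
    show "(INF v\<in>S. f \<omega> v) \<le> (INF v\<in>T. f \<omega> v)"
      by (rule cINF_superset_mono[OF T_ne bdd[OF \<omega>] T(2)]) simp
    have bddT: "bdd_below (f \<omega> ` T)"
      using bdd[OF \<omega>] T(2) by (meson bdd_below_mono image_mono)
    show "(INF v\<in>T. f \<omega> v) \<le> (INF v\<in>S. f \<omega> v)"
    proof (rule cINF_greatest[OF ne])
      fix v assume v: "v \<in> S"
      then have "v \<in> closure T" using T(3) by auto
      then obtain s where s: "\<And>n. s n \<in> T" "s \<longlonglongrightarrow> v"
        by (auto simp: closure_sequential)
      have "(\<lambda>n. f \<omega> (s n)) \<longlonglongrightarrow> f \<omega> v"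
        using cont[OF \<omega>] v s T(2) by (auto simp: continuous_on_sequentially comp_def)
      moreover have "(INF v\<in>T. f \<omega> v) \<le> f \<omega> (s n)" for n
        by (rule cINF_lower[OF bddT s(1)])
      ultimately show "(INF v\<in>T. f \<omega> v) \<le> f \<omega> v"
        by (intro LIMSEQ_le_const) auto
    qed
  qed
  moreover have "(\<lambda>\<omega>. INF v\<in>T. f \<omega> v) \<in> borel_measurable M"
    using T(1,2) meas by (intro borel_measurable_cINF_real) auto
  ultimately show ?thesis by (simp cong: measurable_cong)
qed

text \<open>On a compact set the infimum is attained, so the uncountable existential is equivalent
  to an inequality for a measurable infimum.\<close>

lemma pred_ex_le_zero_compact:
  fixes f :: "'a \<Rightarrow> 'b :: {metric_space, second_countable_topology} \<Rightarrow> real"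
  assumes S: "compact S"
    and meas: "\<And>v. v \<in> S \<Longrightarrow> (\<lambda>\<omega>. f \<omega> v) \<in> borel_measurable M"
    and cont: "\<And>\<omega>. \<omega> \<in> space M \<Longrightarrow> continuous_on S (f \<omega>)"
  shows "Measurable.pred M (\<lambda>\<omega>. \<exists>v\<in>S. f \<omega> v \<le> 0)"
proof (cases "S = {}")
  case False
  have bdd: "bdd_below (f \<omega> ` S)" if "\<omega> \<in> space M" for \<omega>
    by (intro bounded_imp_bdd_below compact_imp_bounded compact_continuous_image cont that S)
  have [measurable]: "(\<lambda>\<omega>. INF v\<in>S. f \<omega> v) \<in> borel_measurable M"
    by (intro borel_measurable_INF_continuous meas cont bdd False)
  have "(\<exists>v\<in>S. f \<omega> v \<le> 0) \<longleftrightarrow> (INF v\<in>S. f \<omega> v) \<le> 0" if \<omega>: "\<omega> \<in> space M" for \<omega>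
  proof
    assume "\<exists>v\<in>S. f \<omega> v \<le> 0"
    then show "(INF v\<in>S. f \<omega> v) \<le> 0"
      using cINF_lower[OF bdd[OF \<omega>]] by (meson order_trans)
  next
    obtain v where "v \<in> S" "\<forall>u\<in>S. f \<omega> v \<le> f \<omega> u"
      using continuous_attains_inf[OF S False cont[OF \<omega>]] by blast
    moreover from this have "f \<omega> v \<le> (INF v\<in>S. f \<omega> v)"
      by (intro cINF_greatest[OF False]) auto
    moreover assume "(INF v\<in>S. f \<omega> v) \<le> 0"
    ultimately show "\<exists>v\<in>S. f \<omega> v \<le> 0" by force
  qed
  then show ?thesis by (simp cong: measurable_cong)
qed simp

section \<open>Random rows are injective on small subspaces\<close>

text \<open>By homogeneity only unit vectors of \<open>U\<close> matter. They form a compact set,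
  and the sum of squares packs all the equations into one continuous function, which is the form
  required by \<open>pred_ex_le_zero_compact\<close>.\<close>

lemma injective_on_subspace_iff:
  fixes A :: "'i \<Rightarrow> 'a :: euclidean_space"
  assumes "finite I" "subspace U"
  shows "(\<forall>u\<in>U. (\<forall>i\<in>I. A i \<bullet> u = 0) \<longrightarrow> u = 0) \<longleftrightarrow>
           \<not> (\<exists>u\<in>U \<inter> sphere 0 1. (\<Sum>i\<in>I. (A i \<bullet> u)\<^sup>2) \<le> 0)"
proof (intro iffI ballI impI notI)
  fix u
  assume *: "\<not> (\<exists>u\<in>U \<inter> sphere 0 1. (\<Sum>i\<in>I. (A i \<bullet> u)\<^sup>2) \<le> 0)"
    and u: "u \<in> U" "\<forall>i\<in>I. A i \<bullet> u = 0"
  show "u = 0"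
  proof (rule ccontr)
    assume "u \<noteq> 0"
    then have "(1 / norm u) *\<^sub>R u \<in> U \<inter> sphere 0 1"
      using u(1) assms(2) by (auto intro: subspace_scale)
    moreover have "(\<Sum>i\<in>I. (A i \<bullet> ((1 / norm u) *\<^sub>R u))\<^sup>2) = 0"
      using u(2) by (intro sum.neutral) auto
    ultimately show False using * by (metis order_refl)
  qed
next
  assume *: "\<forall>u\<in>U. (\<forall>i\<in>I. A i \<bullet> u = 0) \<longrightarrow> u = 0"
    and "\<exists>u\<in>U \<inter> sphere 0 1. (\<Sum>i\<in>I. (A i \<bullet> u)\<^sup>2) \<le> 0"
  then obtain u where u: "u \<in> U" "norm u = 1" "(\<Sum>i\<in>I. (A i \<bullet> u)\<^sup>2) \<le> 0" by auto
  have "(\<Sum>i\<in>I. (A i \<bullet> u)\<^sup>2) = 0"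
    using u(3) by (intro antisym sum_nonneg) auto
  then have "\<forall>i\<in>I. A i \<bullet> u = 0"
    using assms(1) by (subst (asm) sum_nonneg_eq_0_iff) auto
  then show False using * u by force
qed

lemma pred_injective_on_subspace:
  fixes A :: "'w \<Rightarrow> 'i \<Rightarrow> 'a :: euclidean_space"
  assumes I: "finite I" and U: "subspace U"
    and A [measurable]: "\<And>i. i \<in> I \<Longrightarrow> (\<lambda>\<omega>. A \<omega> i) \<in> borel_measurable M"
  shows "Measurable.pred M (\<lambda>\<omega>. \<forall>u\<in>U. (\<forall>i\<in>I. A \<omega> i \<bullet> u = 0) \<longrightarrow> u = 0)"
proof -
  have "Measurable.pred M (\<lambda>\<omega>. \<exists>u\<in>U \<inter> sphere 0 1. (\<Sum>i\<in>I. (A \<omega> i \<bullet> u)\<^sup>2) \<le> 0)"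
    by (intro pred_ex_le_zero_compact closed_Int_compact closed_subspace U)
       (auto intro!: continuous_intros)
  then show ?thesis unfolding injective_on_subspace_iff[OF I U] by measurable
qed

text \<open>Fubini for one distinguished coordinate: the product law is the image of
  \<open>\<nu> k \<Otimes>\<^sub>M PiM I \<nu>\<close> under updating at \<open>k\<close>.
  Measurability of \<open>Q\<close> is what carries the null set through this map.\<close>

lemma AE_PiM_insertI:
  assumes prob: "\<And>i. i \<in> insert k I \<Longrightarrow> prob_space (\<nu> i)"
    and Q: "Measurable.pred (PiM (insert k I) \<nu>) Q"
    and ae: "AE x in \<nu> k. AE A in PiM I \<nu>. Q (A(k := x))"
  shows "AE A in PiM (insert k I) \<nu>. Q A"
proof -
  interpret N: prob_space "\<nu> k" using prob by auto
  interpret I: prob_space "PiM I \<nu>" using prob by (intro prob_space_PiM) auto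
  interpret pair_sigma_finite "\<nu> k" "PiM I \<nu>" by unfold_locales
  have m: "(\<lambda>(x, X). X(k := x)) \<in> measurable (\<nu> k \<Otimes>\<^sub>M PiM I \<nu>) (PiM (insert k I) \<nu>)"
    by measurable
  have "AE p in \<nu> k \<Otimes>\<^sub>M PiM I \<nu>. Q ((\<lambda>(x, X). X(k := x)) p)"
    using ae measurable_compose[OF m Q] by (intro AE_pair_measure) (auto simp: pred_def)
  then have "AE A in distr (\<nu> k \<Otimes>\<^sub>M PiM I \<nu>) (PiM (insert k I) \<nu>) (\<lambda>(x, X). X(k := x)). Q A"
    using Q by (subst AE_distr_iff[OF m]) (auto simp: pred_def)
  then show ?thesis
    using prob by (subst (asm) distr_pair_PiM_eq_PiM) auto
qed

text \<open>Splitting off one row \<open>a\<close> cuts \<open>U\<close> down to its smaller subspace orthogonal to \<open>a\<close>; by Fubini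
  the remaining rows may be treated with \<open>a\<close> fixed.\<close>
lemma AE_injective_on_subspace:
  fixes \<nu> :: "'i \<Rightarrow> 'a :: euclidean_space measure"
  assumes I: "finite I"
    and prob: "\<And>i. i \<in> I \<Longrightarrow> prob_space (\<nu> i)"
    and sets: "\<And>i. i \<in> I \<Longrightarrow> sets (\<nu> i) = sets borel"
    and null: "\<And>i w. i \<in> I \<Longrightarrow> w \<noteq> 0 \<Longrightarrow> AE a in \<nu> i. a \<bullet> w \<noteq> 0"
    and U: "subspace U" "dim U \<le> card I"
  shows "AE A in PiM I \<nu>. \<forall>u\<in>U. (\<forall>i\<in>I. A i \<bullet> u = 0) \<longrightarrow> u = 0"
  using assms
proof (induction I arbitrary: U rule: finite_induct)
  case empty
  then have "U \<subseteq> {0}" by simp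
  then show ?case by auto
next
  case (insert k I)
  show ?case
  proof (cases "U \<subseteq> {0}")
    case True
    then show ?thesis by auto
  next
    case False
    then obtain w where w: "w \<in> U" "w \<noteq> 0" by auto
    have sub: "subspace {u \<in> U. x \<bullet> u = 0}" for x
      using insert.prems(4) by (auto simp: subspace_def inner_add_right)
    show ?thesis
    proof (rule AE_PiM_insertI)
      \<comment> \<open>Measurability is checked on the product of Borel spaces and transferred,
        since the laws \<open>\<nu> i\<close> live on the Borel sets.\<close>
      have sets_eq: "sets (PiM (insert k I) \<nu>) = sets (PiM (insert k I) (\<lambda>_. borel))"
        using insert.prems(2) by (intro sets_PiM_cong) auto
      have "Measurable.pred (PiM (insert k I) (\<lambda>_. borel))
              (\<lambda>A. \<forall>u\<in>U. (\<forall>i\<in>insert k I. A i \<bullet> u = 0) \<longrightarrow> u = 0)"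
        using insert.hyps(1) insert.prems(4) by (intro pred_injective_on_subspace) auto
      then show "Measurable.pred (PiM (insert k I) \<nu>)
              (\<lambda>A. \<forall>u\<in>U. (\<forall>i\<in>insert k I. A i \<bullet> u = 0) \<longrightarrow> u = 0)"
        using measurable_cong_sets[OF sets_eq refl] by blast
      show "AE x in \<nu> k. AE A in PiM I \<nu>.
              \<forall>u\<in>U. (\<forall>i\<in>insert k I. (A(k := x)) i \<bullet> u = 0) \<longrightarrow> u = 0"
        using insert.prems(3)[OF insertI1 w(2)]
      proof (eventually_elim, goal_cases)
        case (1 x)
        have "{u \<in> U. x \<bullet> u = 0} \<subset> U" using w 1 by auto
        then have "dim {u \<in> U. x \<bullet> u = 0} < dim U"
          using insert.prems(4) sub[of x] by (intro dim_psubset) (simp add: span_eq_iff[THEN iffD2])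
        then have "dim {u \<in> U. x \<bullet> u = 0} \<le> card I"
          using insert.prems(5) insert.hyps by simp
        then have "AE A in PiM I \<nu>. \<forall>u\<in>{u \<in> U. x \<bullet> u = 0}. (\<forall>i\<in>I. A i \<bullet> u = 0) \<longrightarrow> u = 0"
          using insert.prems sub by (intro insert.IH) auto
        then show ?case
          by eventually_elim (use insert.hyps(2) in \<open>auto simp: fun_upd_def split: if_splits\<close>)
      qed
    qed (use insert.prems in blast)
  qed
qed

section \<open>Stability of least-squares recovery\<close>

lemma support_subset_iff: "support v \<subseteq> T \<longleftrightarrow> (\<forall>n. n \<notin> T \<longrightarrow> v $ n = 0)"
  by (auto simp: support_def)

lemma subspace_support: "subspace {v :: real^'n. support v \<subseteq> T}"
  by (auto simp: support_subset_iff subspace_def)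

lemma dim_support: "dim {v :: real^'n. support v \<subseteq> T} = card T"
  unfolding support_subset_iff dim_vec_eq[symmetric] by (rule dim_substandard_cart)

text \<open>Rows and measurements are functions on all naturals, but the model fixes them only below
  \<open>m\<close>. This congruence and the next two allow replacing them by expressions that agree
  there.\<close>

lemma residual_norm_cong:
  assumes "\<And>i. i < m \<Longrightarrow> A i = A' i" "\<And>i. i < m \<Longrightarrow> y i = y' i"
  shows "residual_norm m A y = residual_norm m A' y'"
  using assms by (auto simp: residual_norm_def fun_eq_iff intro!: L2_set_cong)

lemma column_span_dist_cong:
  assumes "\<And>i. i < m \<Longrightarrow> A i = A' i" "\<And>i. i < m \<Longrightarrow> y i = y' i"
  shows "column_span_dist m A y = column_span_dist m A' y'"
  using residual_norm_cong[OF assms] by (simp add: column_span_dist_def fun_eq_iff)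

lemma ls_l0_solution_cong:
  assumes "\<And>i. i < m \<Longrightarrow> A i = A' i" "\<And>i. i < m \<Longrightarrow> y i = y' i"
  shows "ls_l0_solution m A y k \<Omega> v \<longleftrightarrow> ls_l0_solution m A' y' k \<Omega> v"
proof -
  have "residual_norm m A y = residual_norm m A' y'" "column_span_dist m A y = column_span_dist m A' y'"
    using assms by (intro residual_norm_cong column_span_dist_cong; simp)+
  then show ?thesis by (simp add: ls_l0_solution_def)
qed

lemma residual_norm_nonneg [simp]: "0 \<le> residual_norm m A y v"
  by (simp add: residual_norm_def)

lemma column_span_dist_le:
  assumes "support v \<subseteq> T"
  shows "column_span_dist m A y T \<le> residual_norm m A y v"
  unfolding column_span_dist_def
  by (rule cINF_lower) (use assms in \<open>auto intro!: bdd_belowI[of _ 0]\<close>)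

lemma column_span_dist_attained:
  obtains v where "support v \<subseteq> T" "column_span_dist m A y T = residual_norm m A y v"
proof -
  obtain v where v: "support v \<subseteq> T" "\<And>u. support u \<subseteq> T \<Longrightarrow> residual_norm m A y v \<le> residual_norm m A y u"
    using least_squares_exists[of m A y T] by (auto simp: is_arg_min_linorder)
  have "residual_norm m A y v \<le> column_span_dist m A y T"
    unfolding column_span_dist_def using v by (intro cINF_greatest) auto
  then show thesis
    using that[OF v(1)] column_span_dist_le[OF v(1)] by (simp add: order_antisym)
qed

text \<open>Since the distance is attained, comparison with all competitors reduces to one real
  inequality, which suits both the perturbation estimates and the measurability arguments.\<close>

lemma is_arg_min_residual_norm_iff:
  "is_arg_min (residual_norm m A y) (\<lambda>u. support u \<subseteq> T) v \<longleftrightarrow>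
     support v \<subseteq> T \<and> residual_norm m A y v \<le> column_span_dist m A y T"
  unfolding is_arg_min_linorder
  by (metis column_span_dist_attained column_span_dist_le order_trans)

lemma residual_norm_eq_0_iff: "residual_norm m A y v = 0 \<longleftrightarrow> (\<forall>i<m. y i = A i \<bullet> v)"
  by (auto simp: residual_norm_def L2_set_eq_0_iff)

lemma residual_norm_linear: "residual_norm m A (\<lambda>i. A i \<bullet> w) v = L2_set (\<lambda>i. A i \<bullet> (w - v)) {..<m}"
  by (simp add: residual_norm_def inner_diff_right)

text \<open>The constant is the smallest singular value of the matrix restricted to
  \<open>U\<close>: the minimum of a continuous function on the unit sphere of \<open>U\<close>,
  positive by injectivity and extended to all of \<open>U\<close> by homogeneity.\<close>

lemma L2_set_linear_lower_bound:
  fixes A :: "nat \<Rightarrow> 'a :: euclidean_space"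
  assumes U: "subspace U" and inj: "\<And>u. u \<in> U \<Longrightarrow> (\<forall>i<m. A i \<bullet> u = 0) \<Longrightarrow> u = 0"
  obtains s where "s > 0" "\<And>u. u \<in> U \<Longrightarrow> s * norm u \<le> L2_set (\<lambda>i. A i \<bullet> u) {..<m}"
proof (cases "U \<inter> sphere 0 1 = {}")
  case True
  have "norm u = 0" if "u \<in> U" for u
  proof (rule ccontr)
    assume "norm u \<noteq> 0"
    then have "(1 / norm u) *\<^sub>R u \<in> U \<inter> sphere 0 1"
      using that U by (auto intro: subspace_scale)
    then show False using True by blast
  qed
  \<comment> \<open>The zero space has no unit vectors to minimise over; the value 1 is an arbitrary
    positive constant.\<close>
  then have "1 * norm u \<le> L2_set (\<lambda>i. A i \<bullet> u) {..<m}" if "u \<in> U" for u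
    using that by (metis L2_set_nonneg mult_zero_right)
  then show thesis by (intro that[of 1]) simp_all
next
  case False
  define f where "f u = L2_set (\<lambda>i. A i \<bullet> u) {..<m}" for u
  have "compact (U \<inter> sphere 0 1)" by (intro closed_Int_compact closed_subspace U) auto
  moreover have "continuous_on (U \<inter> sphere 0 1) f"
    unfolding f_def L2_set_def by (intro continuous_intros)
  ultimately obtain w where w: "w \<in> U \<inter> sphere 0 1" "\<forall>u \<in> U \<inter> sphere 0 1. f w \<le> f u"
    using continuous_attains_inf False by metis
  have "w \<noteq> 0" using w(1) by auto
  then have "\<exists>i<m. A i \<bullet> w \<noteq> 0" using inj[of w] w(1) by blast
  then have "f w \<noteq> 0" by (auto simp: f_def L2_set_eq_0_iff)
  then have "f w > 0" by (simp add: f_def less_le)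
  moreover have "f w * norm u \<le> f u" if u: "u \<in> U" for u
  proof (cases "u = 0")
    case False
    have "(1 / norm u) *\<^sub>R u \<in> U \<inter> sphere 0 1"
      using u U False by (auto intro: subspace_scale)
    then have "f w \<le> f ((1 / norm u) *\<^sub>R u)" using w(2) by blast
    also have "\<dots> = (1 / norm u) * f u"
      using L2_set_left_distrib[of "1 / norm u" "\<lambda>i. A i \<bullet> u" "{..<m}"] by (simp add: f_def)
    finally show ?thesis using False by (simp add: field_simps)
  qed (simp add: f_def)
  ultimately show thesis using that[of "f w"] by (simp add: f_def)
qed

text \<open>This is the deterministic condition that holds almost surely: fits on the true support
  are unique, and each of the finitely many wrong supports of the same size misses the exact
  measurements by a positive distance.\<close>

definition identifiable :: "nat \<Rightarrow> (nat \<Rightarrow> real^'n) \<Rightarrow> real^'n \<Rightarrow> bool" where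
  "identifiable m A z \<longleftrightarrow>
     (\<forall>v. support v \<subseteq> support z \<longrightarrow> (\<forall>i<m. A i \<bullet> v = 0) \<longrightarrow> v = 0) \<and>
     (\<forall>T. card T = card (support z) \<longrightarrow> T \<noteq> support z \<longrightarrow>
        0 < column_span_dist m A (\<lambda>i. A i \<bullet> z) T)"

lemma identifiable_cong:
  assumes "\<And>i. i < m \<Longrightarrow> A i = A' i"
  shows "identifiable m A z \<longleftrightarrow> identifiable m A' z"
proof -
  have "column_span_dist m A (\<lambda>i. A i \<bullet> z) = column_span_dist m A' (\<lambda>i. A' i \<bullet> z)"
    using assms by (intro column_span_dist_cong) auto
  then show ?thesis using assms by (simp add: identifiable_def)
qed

text \<open>Distance to a column span changes by at most the norm of the perturbation. The true
  support then has distance near 0 and every wrong one stays away from 0, so the search eventually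
  picks the true support. Injectivity there turns a small residual into a small error.\<close>

lemma ls_l0_eventually_correct:
  fixes A :: "nat \<Rightarrow> real^'n"
  assumes id: "identifiable m A z" and d: "d \<longlonglongrightarrow> 0" and "\<epsilon> > 0"
  shows "\<forall>\<^sub>F k in sequentially. \<forall>\<Omega> v. ls_l0_solution m A (\<lambda>i. A i \<bullet> (z + d k)) (card (support z)) \<Omega> v
           \<longrightarrow> \<Omega> = support z \<and> norm (v - z) < \<epsilon>"
proof -
  define e where "e k = L2_set (\<lambda>i. A i \<bullet> d k) {..<m}" for k
  have e0: "e \<longlonglongrightarrow> 0"
  proof -
    have "e \<longlonglongrightarrow> L2_set (\<lambda>i. A i \<bullet> 0) {..<m}"
      unfolding e_def L2_set_def by (intro tendsto_intros d)
    then show ?thesis by (simp add: L2_set_def)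
  qed
  have close: "column_span_dist m A (\<lambda>i. A i \<bullet> z) T \<le> column_span_dist m A (\<lambda>i. A i \<bullet> (z + d k)) T + e k" for T k
  proof -
    obtain v where v: "support v \<subseteq> T"
        "column_span_dist m A (\<lambda>i. A i \<bullet> (z + d k)) T = residual_norm m A (\<lambda>i. A i \<bullet> (z + d k)) v"
      by (rule column_span_dist_attained)
    have "column_span_dist m A (\<lambda>i. A i \<bullet> z) T \<le> residual_norm m A (\<lambda>i. A i \<bullet> z) v"
      using v(1) by (rule column_span_dist_le)
    also have "\<dots> = L2_set (\<lambda>i. A i \<bullet> (z + d k - v) + - (A i \<bullet> d k)) {..<m}"
      unfolding residual_norm_linear by (simp add: inner_simps)
    also have "\<dots> \<le> L2_set (\<lambda>i. A i \<bullet> (z + d k - v)) {..<m} + L2_set (\<lambda>i. - (A i \<bullet> d k)) {..<m}"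
      by (rule L2_set_triangle_ineq)
    also have "\<dots> = column_span_dist m A (\<lambda>i. A i \<bullet> (z + d k)) T + e k"
      unfolding v(2) residual_norm_linear e_def by (simp add: L2_set_def)
    finally show ?thesis .
  qed
  \<comment> \<open>The vector \<open>z\<close> itself is a competitor on its support, and its
    residual is exactly the perturbation.\<close>
  have own: "column_span_dist m A (\<lambda>i. A i \<bullet> (z + d k)) (support z) \<le> e k" for k
    using column_span_dist_le[of z "support z" m A "\<lambda>i. A i \<bullet> (z + d k)"]
    by (simp add: residual_norm_linear e_def)
  obtain s where s: "s > 0"
    "\<And>u. support u \<subseteq> support z \<Longrightarrow> s * norm u \<le> L2_set (\<lambda>i. A i \<bullet> u) {..<m}"
    using L2_set_linear_lower_bound[OF subspace_support[of "support z"], of m A] id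
    unfolding identifiable_def by auto
  have "\<forall>\<^sub>F k in sequentially. \<forall>T\<in>{T. card T = card (support z) \<and> T \<noteq> support z}.
          2 * e k < column_span_dist m A (\<lambda>i. A i \<bullet> z) T"
  proof (intro eventually_ball_finite ballI)
    fix T assume "T \<in> {T. card T = card (support z) \<and> T \<noteq> support z}"
    then have "0 < column_span_dist m A (\<lambda>i. A i \<bullet> z) T"
      using id by (simp add: identifiable_def)
    moreover have "(\<lambda>k. 2 * e k) \<longlonglongrightarrow> 2 * 0" by (intro tendsto_intros e0)
    ultimately show "\<forall>\<^sub>F k in sequentially. 2 * e k < column_span_dist m A (\<lambda>i. A i \<bullet> z) T"
      by (intro order_tendstoD) auto
  qed simp
  moreover have "\<forall>\<^sub>F k in sequentially. 2 * e k < s * \<epsilon>"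
  proof -
    have "(\<lambda>k. 2 * e k) \<longlonglongrightarrow> 2 * 0" by (intro tendsto_intros e0)
    then show ?thesis using s(1) \<open>\<epsilon> > 0\<close> by (intro order_tendstoD(2)[of _ 0]) auto
  qed
  ultimately show ?thesis
  proof (eventually_elim, intro allI impI)
    fix k \<Omega> v
    assume sep: "\<forall>T\<in>{T. card T = card (support z) \<and> T \<noteq> support z}.
        2 * e k < column_span_dist m A (\<lambda>i. A i \<bullet> z) T"
      and small: "2 * e k < s * \<epsilon>"
      and sol: "ls_l0_solution m A (\<lambda>i. A i \<bullet> (z + d k)) (card (support z)) \<Omega> v"
    have \<Omega>: "card \<Omega> = card (support z)"
      "column_span_dist m A (\<lambda>i. A i \<bullet> (z + d k)) \<Omega>
         \<le> column_span_dist m A (\<lambda>i. A i \<bullet> (z + d k)) (support z)"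
      and v: "support v \<subseteq> \<Omega>"
        "residual_norm m A (\<lambda>i. A i \<bullet> (z + d k)) v \<le> column_span_dist m A (\<lambda>i. A i \<bullet> (z + d k)) \<Omega>"
      using sol unfolding ls_l0_solution_def is_arg_min_residual_norm_iff
      by (auto simp: is_arg_min_linorder)
    \<comment> \<open>One \<open>e k\<close> pays for passing from perturbed to exact measurements,
      the other bounds the distance of the true support; hence the margin \<open>2 * e k\<close> in
      \<open>sep\<close>.\<close>
    have eq: "\<Omega> = support z"
    proof (rule ccontr)
      assume "\<Omega> \<noteq> support z"
      then have "2 * e k < column_span_dist m A (\<lambda>i. A i \<bullet> z) \<Omega>" using sep \<Omega>(1) by auto
      with close[of \<Omega> k] \<Omega>(2) own[of k] show False by simp
    qed
    \<comment> \<open>With the supports equal, the error lies in the subspace on which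
      \<open>s\<close> bounds the matrix from below. The residual of \<open>v\<close> and the
      perturbation contribute one \<open>e k\<close> each.\<close>
    have "support (v - z) \<subseteq> support z" using v(1) eq by (auto simp: support_subset_iff support_def)
    then have "s * norm (v - z) \<le> L2_set (\<lambda>i. A i \<bullet> (v - z)) {..<m}" by (rule s(2))
    also have "\<dots> = L2_set (\<lambda>i. - (A i \<bullet> (z + d k - v)) + A i \<bullet> d k) {..<m}"
      by (simp add: inner_simps)
    also have "\<dots> \<le> L2_set (\<lambda>i. - (A i \<bullet> (z + d k - v))) {..<m} + e k"
      unfolding e_def by (rule L2_set_triangle_ineq)
    also have "L2_set (\<lambda>i. - (A i \<bullet> (z + d k - v))) {..<m} = residual_norm m A (\<lambda>i. A i \<bullet> (z + d k)) v"
      unfolding residual_norm_linear by (simp add: L2_set_def)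
    also have "\<dots> \<le> e k" using v(2) own[of k] eq by simp
    finally have "s * norm (v - z) < s * \<epsilon>" using small by simp
    then show "\<Omega> = support z \<and> norm (v - z) < \<epsilon>" using eq s(1) by simp
  qed
qed

text \<open>If a wrong support had distance 0, this distance would be attained by some
  \<open>v\<close>, and \<open>z - v\<close> would be a kernel vector in the span of
  \<open>z\<close> and the vectors supported on \<open>T\<close>. Adding only \<open>z\<close> keeps
  the dimension at most one above the sparsity, which is where one extra row suffices.\<close>

lemma identifiableI:
  fixes A :: "nat \<Rightarrow> real^'n"
  assumes inj: "\<And>v. support v \<subseteq> support z \<Longrightarrow> (\<forall>i<m. A i \<bullet> v = 0) \<Longrightarrow> v = 0"
    and inj_insert: "\<And>T u. card T = card (support z) \<Longrightarrow> T \<noteq> support z \<Longrightarrow>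
        u \<in> span (insert z {v. support v \<subseteq> T}) \<Longrightarrow> (\<forall>i<m. A i \<bullet> u = 0) \<Longrightarrow> u = 0"
  shows "identifiable m A z"
  unfolding identifiable_def
proof (intro conjI allI impI)
  fix T assume T: "card T = card (support z)" "T \<noteq> support z"
  obtain v where v: "support v \<subseteq> T"
      "column_span_dist m A (\<lambda>i. A i \<bullet> z) T = residual_norm m A (\<lambda>i. A i \<bullet> z) v"
    by (rule column_span_dist_attained)
  show "0 < column_span_dist m A (\<lambda>i. A i \<bullet> z) T"
  proof (rule ccontr)
    assume "\<not> ?thesis"
    then have "residual_norm m A (\<lambda>i. A i \<bullet> z) v = 0"
      using v(2) residual_norm_nonneg[of m A "\<lambda>i. A i \<bullet> z" v] by linarith
    then have "\<forall>i<m. A i \<bullet> (z - v) = 0" by (simp add: residual_norm_eq_0_iff inner_diff_right)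
    moreover have "z - v \<in> span (insert z {v. support v \<subseteq> T})"
      using v(1) by (intro span_diff span_base) auto
    ultimately have "z = v" using inj_insert[OF T] by fastforce
    \<comment> \<open>Inclusion between finite sets of equal size is equality, contradicting the
      choice of \<open>T\<close>.\<close>
    then have "support z \<subseteq> T" using v(1) by simp
    with T show False by (metis card_subset_eq finite)
  qed
qed (use inj in auto)

section \<open>Measurability of the recovery events\<close>

lemma borel_measurable_vec_component [measurable (raw)]:
  fixes f :: "'a \<Rightarrow> real^'n"
  assumes "f \<in> borel_measurable M"
  shows "(\<lambda>\<omega>. f \<omega> $ n) \<in> borel_measurable M"
  by (rule measurable_compose[OF assms borel_measurable_nth])

lemma measurable_residual_norm:
  fixes A :: "'w \<Rightarrow> nat \<Rightarrow> real^'n"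
  assumes [measurable]: "\<And>i. i < m \<Longrightarrow> (\<lambda>\<omega>. A \<omega> i) \<in> borel_measurable M"
    "\<And>i. i < m \<Longrightarrow> (\<lambda>\<omega>. y \<omega> i) \<in> borel_measurable M"
  shows "(\<lambda>\<omega>. residual_norm m (A \<omega>) (y \<omega>) v) \<in> borel_measurable M"
  unfolding residual_norm_def L2_set_def by measurable

lemma continuous_on_residual_norm: "continuous_on S (residual_norm m A y)"
  unfolding residual_norm_def L2_set_def by (intro continuous_intros)

lemma measurable_column_span_dist:
  fixes A :: "'w \<Rightarrow> nat \<Rightarrow> real^'n"
  assumes "\<And>i. i < m \<Longrightarrow> (\<lambda>\<omega>. A \<omega> i) \<in> borel_measurable M"
    "\<And>i. i < m \<Longrightarrow> (\<lambda>\<omega>. y \<omega> i) \<in> borel_measurable M"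
  shows "(\<lambda>\<omega>. column_span_dist m (A \<omega>) (y \<omega>) T) \<in> borel_measurable M"
  unfolding column_span_dist_def
proof (rule borel_measurable_INF_continuous)
  show "{v :: real^'n. support v \<subseteq> T} \<noteq> {}"
    using subspace_0[OF subspace_support] by blast
qed (auto intro!: measurable_residual_norm assms continuous_on_residual_norm bdd_belowI[of _ 0])

lemma pred_support_eq:
  assumes [measurable]: "z \<in> borel_measurable M"
  shows "Measurable.pred M (\<lambda>\<omega>. support (z \<omega> :: real^'n) = S)"
proof -
  have "Measurable.pred M (\<lambda>\<omega>. \<forall>n\<in>UNIV. (z \<omega> $ n \<noteq> 0) = (n \<in> S))"
    by (intro pred_intros_finite) measurable
  then show ?thesis by (simp add: support_def set_eq_iff)
qed

text \<open>The support of \<open>z \<omega>\<close> takes finitely many values; splitting by its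
  value \<open>S\<close> replaces a random subspace by a fixed one.\<close>

lemma pred_identifiable:
  fixes A :: "'w \<Rightarrow> nat \<Rightarrow> real^'n"
  assumes A [measurable]: "\<And>i. i < m \<Longrightarrow> (\<lambda>\<omega>. A \<omega> i) \<in> borel_measurable M"
    and z [measurable]: "z \<in> borel_measurable M"
  shows "Measurable.pred M (\<lambda>\<omega>. identifiable m (A \<omega>) (z \<omega>))"
proof -
  have [measurable]: "Measurable.pred M (\<lambda>\<omega>. support (z \<omega>) = S)" for S
    by (rule pred_support_eq) measurable
  have [measurable]: "(\<lambda>\<omega>. column_span_dist m (A \<omega>) (\<lambda>i. A \<omega> i \<bullet> z \<omega>) T) \<in> borel_measurable M" for T
    by (rule measurable_column_span_dist) measurable
  define inj where "inj S \<omega> \<longleftrightarrow> (\<forall>u\<in>{v. support v \<subseteq> S}. (\<forall>i\<in>{..<m}. A \<omega> i \<bullet> u = 0) \<longrightarrow> u = 0)"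
    for S \<omega>
  have [measurable]: "Measurable.pred M (inj S)" for S
    unfolding inj_def by (rule pred_injective_on_subspace) (auto intro: subspace_support)
  have "Measurable.pred M (\<lambda>\<omega>. \<forall>S\<in>UNIV. support (z \<omega>) = S \<longrightarrow> inj S \<omega> \<and>
      (\<forall>T\<in>{T. card T = card S \<and> T \<noteq> S}. 0 < column_span_dist m (A \<omega>) (\<lambda>i. A \<omega> i \<bullet> z \<omega>) T))"
    by (intro pred_intros_finite pred_intros_logic(3,4)) measurable
  then show ?thesis
    by (rule measurable_cong[THEN iffD1, rotated]) (auto simp: identifiable_def inj_def)
qed

text \<open>The supports range over a finite set, but the fits do not. Failure on a given support is
  expressed as existence of a bad fit in a compact ball, with \<open>max\<close> merging the two
  conditions "is a fit" and "has error at least \<epsilon>" into one inequality.\<close>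

lemma pred_ls_l0_correct:
  fixes A :: "'w \<Rightarrow> nat \<Rightarrow> real^'n"
  assumes A [measurable]: "\<And>i. i < m \<Longrightarrow> (\<lambda>\<omega>. A \<omega> i) \<in> borel_measurable M"
    and y [measurable]: "\<And>i. i < m \<Longrightarrow> (\<lambda>\<omega>. y \<omega> i) \<in> borel_measurable M"
    and z [measurable]: "z \<in> borel_measurable M"
    and c [measurable]: "c \<in> borel_measurable M"
  shows "Measurable.pred M (\<lambda>\<omega>. \<forall>\<Omega> v. ls_l0_solution m (A \<omega>) (y \<omega>) k \<Omega> v \<longrightarrow>
           \<Omega> = support (z \<omega>) \<and> norm (c \<omega> + v) < \<epsilon>)"
proof -
  have [measurable]: "Measurable.pred M (\<lambda>\<omega>. support (z \<omega>) = S)" for S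
    by (rule pred_support_eq) measurable
  have [measurable]: "(\<lambda>\<omega>. column_span_dist m (A \<omega>) (y \<omega>) T) \<in> borel_measurable M" for T
    by (rule measurable_column_span_dist) measurable
  have [measurable]: "(\<lambda>\<omega>. residual_norm m (A \<omega>) (y \<omega>) v) \<in> borel_measurable M" for v
    by (rule measurable_residual_norm) measurable
  \<comment> \<open>The least-squares fits need not form a bounded set, so they are exhausted by compact balls.\<close>
  define far where "far \<Omega> R \<omega> \<longleftrightarrow> (\<exists>v\<in>{v. support v \<subseteq> \<Omega>} \<inter> cball 0 R.
      max (residual_norm m (A \<omega>) (y \<omega>) v - column_span_dist m (A \<omega>) (y \<omega>) \<Omega>)
        (\<epsilon> - norm (c \<omega> + v)) \<le> 0)" for \<Omega> R \<omega>
  have [measurable]: "Measurable.pred M (far \<Omega> R)" for \<Omega> R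
    unfolding far_def
    by (intro pred_ex_le_zero_compact closed_Int_compact closed_subspace subspace_support
          continuous_intros continuous_on_residual_norm) measurable
  have "Measurable.pred M (\<lambda>\<omega>. \<forall>\<Omega>\<in>{\<Omega>. card \<Omega> = k}.
      (\<forall>T\<in>{T. card T = k}. column_span_dist m (A \<omega>) (y \<omega>) \<Omega> \<le> column_span_dist m (A \<omega>) (y \<omega>) T) \<longrightarrow>
      support (z \<omega>) = \<Omega> \<and> (\<forall>R. \<not> far \<Omega> (real R) \<omega>))"
    by (intro pred_intros_finite pred_intros_logic(3,4)) measurable
  moreover have "(\<forall>\<Omega> v. ls_l0_solution m (A \<omega>) (y \<omega>) k \<Omega> v \<longrightarrow>
           \<Omega> = support (z \<omega>) \<and> norm (c \<omega> + v) < \<epsilon>) \<longleftrightarrow>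
      (\<forall>\<Omega>\<in>{\<Omega>. card \<Omega> = k}.
      (\<forall>T\<in>{T. card T = k}. column_span_dist m (A \<omega>) (y \<omega>) \<Omega> \<le> column_span_dist m (A \<omega>) (y \<omega>) T) \<longrightarrow>
      support (z \<omega>) = \<Omega> \<and> (\<forall>R. \<not> far \<Omega> (real R) \<omega>))" for \<omega>
  proof -
    \<comment> \<open>Without a fit on a minimising \<open>\<Omega>\<close> the left side would say
      nothing about that \<open>\<Omega>\<close>, whereas the right side demands that it is the true
      support.\<close>
    have ex: "\<exists>v. support v \<subseteq> \<Omega> \<and> residual_norm m (A \<omega>) (y \<omega>) v \<le> column_span_dist m (A \<omega>) (y \<omega>) \<Omega>" for \<Omega>
      by (metis column_span_dist_attained order_refl)
    have ball: "(\<forall>R. \<not> far \<Omega> (real R) \<omega>) \<longleftrightarrow>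
        (\<forall>v. support v \<subseteq> \<Omega> \<longrightarrow> residual_norm m (A \<omega>) (y \<omega>) v \<le> column_span_dist m (A \<omega>) (y \<omega>) \<Omega>
           \<longrightarrow> norm (c \<omega> + v) < \<epsilon>)" for \<Omega>
      unfolding far_def using real_arch_simple by (fastforce simp: not_le)
    show ?thesis
      unfolding ball ls_l0_solution_def is_arg_min_residual_norm_iff
      unfolding is_arg_min_linorder using ex by blast
  qed
  ultimately show ?thesis by simp
qed

section \<open>Moments and supports of innovations\<close>

lemma measurable_zero_extension:
  assumes N: "sets N = sets (borel :: real measure)"
  shows "(\<lambda>g. (\<chi> n. if n \<in> S then g n else 0) :: real^'n) \<in> borel_measurable (\<Pi>\<^sub>M n\<in>S. N)"
proof (subst borel_measurable_euclidean_space, safe)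
  fix b :: "real^'n" assume "b \<in> Basis"
  then obtain k where b: "b = axis k 1" by (auto simp: Basis_vec_def)
  have "(\<lambda>g. g k) \<in> borel_measurable (\<Pi>\<^sub>M n\<in>S. N)" if "k \<in> S"
    using measurable_component_singleton[OF that, of "\<lambda>_. N"] measurable_cong_sets[OF refl N] by blast
  then show "(\<lambda>g. (\<chi> n. if n \<in> S then g n else 0) \<bullet> b) \<in> borel_measurable (\<Pi>\<^sub>M n\<in>S. N)"
    unfolding b inner_axis by (cases "k \<in> S") simp_all
qed

lemma nn_integral_innovation_law:
  fixes f :: "real^'n \<Rightarrow> ennreal"
  assumes \<tau>: "\<tau> > 0" and f: "f \<in> borel_measurable borel"
  shows "(\<integral>\<^sup>+v. f v \<partial>innovation_law k \<tau>) =
    (\<integral>\<^sup>+S. (\<integral>\<^sup>+g. f (\<chi> n. if n \<in> S then g n else 0)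
        \<partial>(\<Pi>\<^sub>M n\<in>S. density lborel (normal_density 0 \<tau>))) \<partial>measure_pmf (pmf_of_set {S :: 'n set. card S = k}))"
  unfolding innovation_law_def
  using f by (subst nn_integral_bind[OF f measurable_prob_algebraD[OF innovation_law_kernel[OF \<tau>]]])
     (intro nn_integral_cong nn_integral_distr measurable_zero_extension, simp_all)

text \<open>A single coordinate is a mixture of the Gaussian law, when its position is drawn, and a
  point mass at 0 otherwise.\<close>

lemma nn_integral_innovation_component:
  fixes h :: "real \<Rightarrow> ennreal"
  assumes \<tau>: "\<tau> > 0" and h [measurable]: "h \<in> borel_measurable borel"
  shows "(\<integral>\<^sup>+v. h (v $ n) \<partial>(innovation_law k \<tau> :: (real^'n) measure)) =
    (\<integral>\<^sup>+S. (if n \<in> S then \<integral>\<^sup>+t. ennreal (normal_density 0 \<tau> t) * h t \<partial>lborel else h 0)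
       \<partial>measure_pmf (pmf_of_set {S :: 'n set. card S = k}))"
proof -
  interpret N: prob_space "density lborel (normal_density 0 \<tau>)"
    using \<tau> by (rule prob_space_normal_density)
  have "(\<integral>\<^sup>+g. h ((\<chi> n. if n \<in> S then g n else 0) $ n) \<partial>(\<Pi>\<^sub>M n\<in>S. density lborel (normal_density 0 \<tau>))) =
      (if n \<in> S then \<integral>\<^sup>+t. ennreal (normal_density 0 \<tau> t) * h t \<partial>lborel else h 0)" for S :: "'n set"
  proof (cases "n \<in> S")
    case True
    have "(\<integral>\<^sup>+g. h (g n) \<partial>(\<Pi>\<^sub>M n\<in>S. density lborel (normal_density 0 \<tau>))) =
        (\<integral>\<^sup>+t. h t \<partial>distr (\<Pi>\<^sub>M n\<in>S. density lborel (normal_density 0 \<tau>))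
            (density lborel (normal_density 0 \<tau>)) (\<lambda>g. g n))"
      using True by (subst nn_integral_distr) auto
    also have "\<dots> = (\<integral>\<^sup>+t. h t \<partial>density lborel (normal_density 0 \<tau>))"
      using True by (subst distr_PiM_component) (auto intro: N.prob_space_axioms)
    also have "\<dots> = (\<integral>\<^sup>+t. ennreal (normal_density 0 \<tau> t) * h t \<partial>lborel)"
      by (subst nn_integral_density) auto
    finally show ?thesis using True by simp
  next
    case False
    interpret prob_space "\<Pi>\<^sub>M n\<in>S. density lborel (normal_density 0 \<tau>)"
      by (intro prob_space_PiM N.prob_space_axioms)
    show ?thesis using False by (simp add: emeasure_space_1)
  qed
  then show ?thesis
    by (subst nn_integral_innovation_law[OF \<tau>]) simp_all
qed

text \<open>Given the support, a coordinate is either Gaussian with variance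
  \<open>\<tau>\<^sup>2\<close> or 0, which bounds the second moment. The mean vanishes by
  symmetry.\<close>

lemma innovation_law_moments:
  fixes n :: "'n::finite" and k :: nat
  assumes \<tau>: "\<tau> > 0"
  defines "L \<equiv> innovation_law k \<tau> :: (real^'n) measure"
  shows "integrable L (\<lambda>v. (v $ n)\<^sup>2)" "(\<integral>v. (v $ n)\<^sup>2 \<partial>L) \<le> \<tau>\<^sup>2" "(\<integral>v. v $ n \<partial>L) = 0"
proof -
  interpret L: prob_space L unfolding L_def by (rule prob_space_innovation_law[OF \<tau>])
  have [measurable_cong]: "sets L = sets borel"
    unfolding L_def by (rule prob_space_innovation_law[OF \<tau>])
  have "(\<integral>\<^sup>+v. ennreal ((v $ n)\<^sup>2) \<partial>L) \<le> (\<integral>\<^sup>+S. ennreal (\<tau>\<^sup>2) \<partial>measure_pmf (pmf_of_set {S :: 'n set. card S = k}))"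
  proof -
    have "(\<integral>\<^sup>+t. ennreal (normal_density 0 \<tau> t) * ennreal (t\<^sup>2) \<partial>lborel) = ennreal (\<tau>\<^sup>2)"
      using nn_integral_eq_integral[OF integrable.intros[OF normal_moment_even[OF \<tau>, of 0 1]]]
        integral_normal_moment_even[OF \<tau>, of 0 1]
      by (simp add: ennreal_mult'[symmetric])
    then show ?thesis
      unfolding L_def
      using nn_integral_innovation_component[OF \<tau>, of "\<lambda>t. ennreal (t\<^sup>2)" k n]
      by (simp del: nn_integral_const) (intro nn_integral_mono, simp)
  qed
  then have le: "(\<integral>\<^sup>+v. ennreal ((v $ n)\<^sup>2) \<partial>L) \<le> ennreal (\<tau>\<^sup>2)"
    by (simp add: measure_pmf.emeasure_space_1)
  show sq: "integrable L (\<lambda>v. (v $ n)\<^sup>2)"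
    by (rule integrableI_bounded) (use le in \<open>auto simp: top_unique less_top[symmetric]\<close>)
  show "(\<integral>v. (v $ n)\<^sup>2 \<partial>L) \<le> \<tau>\<^sup>2"
    using le by (subst (asm) nn_integral_eq_integral[OF sq]) auto
  have "integrable L (\<lambda>v. v $ n)"
    by (rule L.square_integrable_imp_integrable[OF _ sq]) measurable
  \<comment> \<open>The mixture formula is available for nonnegative integrands only, so positive
    and negative parts are compared; the reflection of the Gaussian density makes them
    equal.\<close>
  then have "(\<integral>v. v $ n \<partial>L) = enn2real (\<integral>\<^sup>+v. ennreal (v $ n) \<partial>L) - enn2real (\<integral>\<^sup>+v. ennreal (- (v $ n)) \<partial>L)"
    by (rule real_lebesgue_integral_def)
  also have "(\<integral>\<^sup>+v. ennreal (- (v $ n)) \<partial>L) = (\<integral>\<^sup>+v. ennreal (v $ n) \<partial>L)"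
  proof -
    have "(\<integral>\<^sup>+t. ennreal (normal_density 0 \<tau> t) * ennreal t \<partial>lborel) =
        (\<integral>\<^sup>+t. ennreal (normal_density 0 \<tau> t) * ennreal (- t) \<partial>lborel)"
      by (subst nn_integral_real_affine[where c = "-1" and t = 0]) (simp_all add: normal_density_def)
    then show ?thesis
      unfolding L_def
      by (subst nn_integral_innovation_component[OF \<tau>, of "\<lambda>t. ennreal (- t)"], simp)
         (subst nn_integral_innovation_component[OF \<tau>, of ennreal], simp_all cong: if_cong)
  qed
  finally show "(\<integral>v. v $ n \<partial>L) = 0" by simp
qed

text \<open>Gaussian coefficients are almost surely nonzero, so the support is the whole drawn set.
  The bound on \<open>k\<close> ensures that there is a set to draw.\<close>

lemma AE_innovation_law_card_support:
  assumes \<tau>: "\<tau> > 0" and k: "k \<le> CARD('n)"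
  shows "AE v in (innovation_law k \<tau> :: (real^'n) measure). card (support v) = k"
proof -
  interpret N: prob_space "density lborel (normal_density 0 \<tau>)"
    using \<tau> by (rule prob_space_normal_density)
  have nz: "AE t in density lborel (normal_density 0 \<tau>). t \<noteq> 0"
    using AE_lborel_singleton[of "0 :: real"] by (subst AE_density) auto
  have ae: "AE v in distr (\<Pi>\<^sub>M n\<in>S. density lborel (normal_density 0 \<tau>)) borel
          (\<lambda>g. (\<chi> n. if n \<in> S then g n else 0) :: real^'n). support v = S" for S :: "'n set"
  proof (subst AE_distr_iff)
    show "(\<lambda>g. (\<chi> n. if n \<in> S then g n else 0) :: real^'n)
        \<in> borel_measurable (\<Pi>\<^sub>M n\<in>S. density lborel (normal_density 0 \<tau>))"
      by (rule measurable_zero_extension) simp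
    show "{v \<in> space borel. support v = S} \<in> sets borel"
      using pred_support_eq[of "\<lambda>v. v" borel S] by (simp add: pred_def)
    have "AE g in (\<Pi>\<^sub>M n\<in>S. density lborel (normal_density 0 \<tau>)). \<forall>n\<in>S. g n \<noteq> 0"
      using nz by (intro AE_finite_allI AE_PiM_component N.prob_space_axioms) auto
    then show "AE g in (\<Pi>\<^sub>M n\<in>S. density lborel (normal_density 0 \<tau>)).
        support ((\<chi> n. if n \<in> S then g n else 0) :: real^'n) = S"
      by eventually_elim (auto simp: support_def)
  qed
  have "\<exists>S :: 'n set. card S = k"
    using obtain_subset_with_card_n[OF k] by metis
  then have "AE S in measure_pmf (pmf_of_set {S :: 'n set. card S = k}). card S = k"
    by (subst AE_measure_pmf_iff) (auto simp: set_pmf_of_set)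
  then have "AE S in measure_pmf (pmf_of_set {S :: 'n set. card S = k}).
      AE v in distr (\<Pi>\<^sub>M n\<in>S. density lborel (normal_density 0 \<tau>)) borel
          (\<lambda>g. (\<chi> n. if n \<in> S then g n else 0) :: real^'n). card (support v) = k"
  proof eventually_elim
    case (elim S)
    from ae[of S] show ?case by eventually_elim (simp add: elim)
  qed
  \<comment> \<open>The cardinality condition is written as a finite union of events fixing the
    support.\<close>
  moreover have "Measurable.pred borel (\<lambda>v :: real^'n. \<exists>S\<in>{S. card S = k}. support v = S)"
    by (intro pred_intros_finite pred_support_eq) auto
  then have "Measurable.pred borel (\<lambda>v :: real^'n. card (support v) = k)" by simp
  ultimately show ?thesis
    unfolding innovation_law_def
    by (subst AE_bind[OF measurable_prob_algebraD[OF innovation_law_kernel[OF \<tau>]]]) auto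
qed

section \<open>Gaussian entries and the weak law\<close>

lemma (in prob_space) indep_vars_imp_indep_var_comp:
  assumes ind: "indep_vars M' X I" and ij: "i \<in> I" "j \<in> I" "i \<noteq> j"
    and f: "f \<in> measurable (M' i) N1" and g: "g \<in> measurable (M' j) N2"
  shows "indep_var N1 (\<lambda>\<omega>. f (X i \<omega>)) N2 (\<lambda>\<omega>. g (X j \<omega>))"
proof -
  have fm: "(\<lambda>h. f (h i)) \<in> measurable (PiM {i} M') N1"
    by (rule measurable_compose[OF measurable_component_singleton[of i "{i}" M'] f]) simp
  have gm: "(\<lambda>h. g (h j)) \<in> measurable (PiM {j} M') N2"
    by (rule measurable_compose[OF measurable_component_singleton[of j "{j}" M'] g]) simp
  have "indep_var (PiM {i} M') (\<lambda>\<omega>. restrict (\<lambda>i. X i \<omega>) {i}) (PiM {j} M') (\<lambda>\<omega>. restrict (\<lambda>i. X i \<omega>) {j})"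
    using ij by (intro indep_var_restrict[OF ind]) auto
  from indep_var_compose[OF this fm gm] show ?thesis by (simp add: comp_def)
qed

text \<open>The inner product is a weighted sum of independent centred Gaussians, hence normal with
  positive variance, and a law with a density has no atom at 0.\<close>

lemma (in prob_space) AE_normal_entries_inner_nonzero:
  fixes X :: "'a \<Rightarrow> real^'n"
  assumes normal: "\<And>n. distributed M lborel (\<lambda>\<omega>. X \<omega> $ n) (normal_density 0 s)"
    and s: "s > 0"
    and ind: "indep_vars (\<lambda>_. borel) (\<lambda>n \<omega>. X \<omega> $ n) UNIV"
    and w: "w \<noteq> 0"
  shows "AE \<omega> in M. X \<omega> \<bullet> w \<noteq> 0"
proof -
  \<comment> \<open>Zero weights are dropped because a normal law with standard deviation 0 has no
    density.\<close>
  define I where "I = {n. w $ n \<noteq> 0}"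
  define t where "t = sqrt (\<Sum>n\<in>I. (\<bar>w $ n\<bar> * s)\<^sup>2)"
  have "I \<noteq> {}" using w by (auto simp: I_def vec_eq_iff)
  have "distributed M lborel (\<lambda>\<omega>. \<Sum>n\<in>I. w $ n * X \<omega> $ n) (normal_density (\<Sum>n\<in>I. 0) t)"
    unfolding t_def
  proof (rule sum_indep_normal)
    show "indep_vars (\<lambda>_. borel) (\<lambda>n \<omega>. w $ n * X \<omega> $ n) I"
      by (rule indep_vars_compose2[OF indep_vars_subset[OF ind]]) auto
    show "distributed M lborel (\<lambda>\<omega>. w $ n * X \<omega> $ n) (normal_density 0 (\<bar>w $ n\<bar> * s))" if "n \<in> I" for n
      using normal_density_affine[OF normal s, of "w $ n" 0 n] that by (simp add: I_def)
  qed (use \<open>I \<noteq> {}\<close> s in \<open>auto simp: I_def\<close>)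
  then have "distributed M lborel (\<lambda>\<omega>. \<Sum>n\<in>I. w $ n * X \<omega> $ n) (normal_density 0 t)" by simp
  then have "AE \<omega> in M. (\<Sum>n\<in>I. w $ n * X \<omega> $ n) \<noteq> 0"
    using AE_lborel_singleton[of "0 :: real"] by (subst distributed_AE2) auto
  moreover have "(\<Sum>n\<in>I. w $ n * X \<omega> $ n) = X \<omega> \<bullet> w" for \<omega>
    unfolding inner_vec_def I_def by (intro sum.mono_neutral_cong_left) (auto simp: mult.commute)
  ultimately show ?thesis by simp
qed

section \<open>Moment bounds and mean-square convergence\<close>

lemma (in prob_space) normal_distributed_moments:
  assumes X: "distributed M lborel X (normal_density 0 s)" and s: "s > 0"
  shows "integrable M (\<lambda>\<omega>. X \<omega> ^ k)"
    and "expectation X = 0"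
    and "expectation (\<lambda>\<omega>. X \<omega> ^ 2) = s\<^sup>2"
    and "expectation (\<lambda>\<omega>. X \<omega> ^ 4) = 3 * s ^ 4"
proof -
  show "integrable M (\<lambda>\<omega>. X \<omega> ^ k)"
    using integrable_normal_moment[OF s, of 0 k]
    by (subst distributed_integrable[OF X, of "\<lambda>x. x ^ k", symmetric]) simp_all
  show "expectation X = 0"
    using normal_distributed_expectation[OF s X] .
  show "expectation (\<lambda>\<omega>. X \<omega> ^ 2) = s\<^sup>2"
    using integral_normal_moment_even[OF s, of 0 1]
    by (subst distributed_integral[OF X, of "\<lambda>x. x ^ 2", symmetric]) (simp_all add: field_simps power2_eq_square)
  show "expectation (\<lambda>\<omega>. X \<omega> ^ 4) = 3 * s ^ 4"
    using integral_normal_moment_even[OF s, of 0 2] s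
    by (subst distributed_integral[OF X, of "\<lambda>x. x ^ 4", symmetric])
       (simp_all add: fact_numeral field_simps power2_eq_square eval_nat_numeral)
qed

text \<open>Cauchy-Schwarz gives the squared cardinality as factor. The summands may be dependent,
  as are the contributions of the rows of one matrix, which share an innovation.\<close>

lemma (in prob_space) sum_square_moment_le:
  fixes X :: "'i \<Rightarrow> 'a \<Rightarrow> real"
  assumes I: "finite I"
    and rv [measurable]: "\<And>i. i \<in> I \<Longrightarrow> X i \<in> borel_measurable M"
    and int: "\<And>i. i \<in> I \<Longrightarrow> integrable M (\<lambda>\<omega>. (X i \<omega>)\<^sup>2)"
    and le: "\<And>i. i \<in> I \<Longrightarrow> expectation (\<lambda>\<omega>. (X i \<omega>)\<^sup>2) \<le> c"
  shows "integrable M (\<lambda>\<omega>. (\<Sum>i\<in>I. X i \<omega>)\<^sup>2)"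
    and "expectation (\<lambda>\<omega>. (\<Sum>i\<in>I. X i \<omega>)\<^sup>2) \<le> (real (card I))\<^sup>2 * c"
proof -
  have bound: "(\<Sum>i\<in>I. X i \<omega>)\<^sup>2 \<le> real (card I) * (\<Sum>i\<in>I. (X i \<omega>)\<^sup>2)" for \<omega>
    using sum_squared_le_sum_of_squares[of "\<lambda>i. X i \<omega>" I] I by (simp add: mult.commute)
  have int_sum: "integrable M (\<lambda>\<omega>. real (card I) * (\<Sum>i\<in>I. (X i \<omega>)\<^sup>2))"
    using int by (intro integrable_mult_right Bochner_Integration.integrable_sum) auto
  show *: "integrable M (\<lambda>\<omega>. (\<Sum>i\<in>I. X i \<omega>)\<^sup>2)"
    using bound by (intro Bochner_Integration.integrable_bound[OF int_sum] AE_I2)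
      (auto simp: sum_nonneg)
  have "expectation (\<lambda>\<omega>. (\<Sum>i\<in>I. X i \<omega>)\<^sup>2) \<le> expectation (\<lambda>\<omega>. real (card I) * (\<Sum>i\<in>I. (X i \<omega>)\<^sup>2))"
    by (rule integral_mono[OF * int_sum bound])
  also have "\<dots> = real (card I) * (\<Sum>i\<in>I. expectation (\<lambda>\<omega>. (X i \<omega>)\<^sup>2))"
    using int by (simp add: Bochner_Integration.integral_sum)
  also have "\<dots> \<le> real (card I) * (real (card I) * c)"
    using sum_bounded_above[of I "\<lambda>i. expectation (\<lambda>\<omega>. (X i \<omega>)\<^sup>2)" c] le
    by (intro mult_left_mono) auto
  finally show "expectation (\<lambda>\<omega>. (\<Sum>i\<in>I. X i \<omega>)\<^sup>2) \<le> (real (card I))\<^sup>2 * c"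
    by (simp add: power2_eq_square mult.assoc)
qed

text \<open>Of the \<open>J\<^sup>2\<close> covariances in the expanded square only the diagonal
  ones survive. Each is at most \<open>c\<close>, since a variance never exceeds the second moment,
  so the error is at most \<open>c / J\<close>.\<close>

lemma (in prob_space) L2_weak_law:
  fixes X :: "nat \<Rightarrow> 'a \<Rightarrow> real"
  assumes ind: "indep_vars (\<lambda>_. borel) X UNIV"
    and sq: "\<And>l. integrable M (\<lambda>\<omega>. (X l \<omega>)\<^sup>2)"
    and mean: "\<And>l. expectation (X l) = \<mu>"
    and bound: "\<And>l. expectation (\<lambda>\<omega>. (X l \<omega>)\<^sup>2) \<le> c"
  shows "integrable M (\<lambda>\<omega>. ((1 / real J) * (\<Sum>l<J. X l \<omega>) - \<mu>)\<^sup>2)"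
    and "(\<lambda>J. expectation (\<lambda>\<omega>. ((1 / real J) * (\<Sum>l<J. X l \<omega>) - \<mu>)\<^sup>2)) \<longlonglongrightarrow> 0"
proof -
  have rv [measurable]: "X l \<in> borel_measurable M" for l
    using ind by (auto simp: indep_vars_def)
  have int: "integrable M (X l)" for l
    by (rule square_integrable_imp_integrable[OF rv sq])
  show sqJ: "integrable M (\<lambda>\<omega>. ((1 / real J) * (\<Sum>l<J. X l \<omega>) - \<mu>)\<^sup>2)" for J
  proof -
    have "integrable M (\<lambda>\<omega>. (\<Sum>l<J. X l \<omega>)\<^sup>2)"
      by (rule sum_square_moment_le(1)[where c = c]) (use sq bound in auto)
    moreover have "((1 / real J) * (\<Sum>l<J. X l \<omega>) - \<mu>)\<^sup>2 = (1 / real J)\<^sup>2 * (\<Sum>l<J. X l \<omega>)\<^sup>2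
        - (2 * \<mu> / real J) * (\<Sum>l<J. X l \<omega>) + \<mu>\<^sup>2" for \<omega>
      by (simp add: power2_eq_square algebra_simps)
    ultimately show ?thesis using int by simp
  qed
  have uncorrelated: "expectation (\<lambda>\<omega>. (X l \<omega> - \<mu>) * (X k \<omega> - \<mu>)) = 0"
    "integrable M (\<lambda>\<omega>. (X l \<omega> - \<mu>) * (X k \<omega> - \<mu>))" if "l \<noteq> k" for l k
  proof -
    have iv: "indep_var borel (\<lambda>\<omega>. X l \<omega> - \<mu>) borel (\<lambda>\<omega>. X k \<omega> - \<mu>)"
      by (rule indep_vars_imp_indep_var_comp[OF ind, where f = "\<lambda>x. x - \<mu>" and g = "\<lambda>x. x - \<mu>"]) (use that in auto)
    show "expectation (\<lambda>\<omega>. (X l \<omega> - \<mu>) * (X k \<omega> - \<mu>)) = 0"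
      using int mean by (subst indep_var_lebesgue_integral[OF iv]) (auto simp: prob_space)
    show "integrable M (\<lambda>\<omega>. (X l \<omega> - \<mu>) * (X k \<omega> - \<mu>))"
      using int by (intro indep_var_integrable[OF iv]) auto
  qed
  have sq': "integrable M (\<lambda>\<omega>. (X l \<omega> - \<mu>) * (X l \<omega> - \<mu>))" for l
    using sq[of l] int[of l] by (simp add: algebra_simps power2_eq_square)
  have var: "expectation (\<lambda>\<omega>. (X l \<omega> - \<mu>) * (X l \<omega> - \<mu>)) \<le> c" for l
  proof -
    have "expectation (\<lambda>\<omega>. (X l \<omega> - \<mu>) * (X l \<omega> - \<mu>)) = expectation (\<lambda>\<omega>. (X l \<omega>)\<^sup>2) - \<mu>\<^sup>2"
      using variance_eq[OF int sq, of l] mean by (simp add: power2_eq_square)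
    then show ?thesis using bound[of l] by (smt (verit) zero_le_power2)
  qed
  \<comment> \<open>At \<open>J = 0\<close> division by zero yields 0, so the error is
    \<open>\<mu>\<^sup>2\<close> while the bound is 0; this case is excluded and does not affect the
    limit.\<close>
  have le: "expectation (\<lambda>\<omega>. ((1 / real J) * (\<Sum>l<J. X l \<omega>) - \<mu>)\<^sup>2) \<le> c * (1 / real J)" if J: "J > 0" for J
  proof -
    have "((1 / real J) * (\<Sum>l<J. X l \<omega>) - \<mu>)\<^sup>2 =
        (1 / real J)\<^sup>2 * (\<Sum>l<J. \<Sum>k<J. (X l \<omega> - \<mu>) * (X k \<omega> - \<mu>))" for \<omega>
    proof -
      have "(1 / real J) * (\<Sum>l<J. X l \<omega>) - \<mu> = (1 / real J) * (\<Sum>l<J. X l \<omega> - \<mu>)"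
        using J by (simp add: sum_subtractf field_simps)
      then show ?thesis by (simp only: power_mult_distrib) (simp add: power2_eq_square sum_product)
    qed
    moreover have ik: "integrable M (\<lambda>\<omega>. (X l \<omega> - \<mu>) * (X k \<omega> - \<mu>))" for l k
      using uncorrelated(2) sq' by (cases "l = k") auto
    ultimately have "expectation (\<lambda>\<omega>. ((1 / real J) * (\<Sum>l<J. X l \<omega>) - \<mu>)\<^sup>2)
        = (1 / real J)\<^sup>2 * (\<Sum>l<J. \<Sum>k<J. expectation (\<lambda>\<omega>. (X l \<omega> - \<mu>) * (X k \<omega> - \<mu>)))"
      by (simp add: Bochner_Integration.integral_sum)
    also have "(\<Sum>l<J. \<Sum>k<J. expectation (\<lambda>\<omega>. (X l \<omega> - \<mu>) * (X k \<omega> - \<mu>)))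
        = (\<Sum>l<J. expectation (\<lambda>\<omega>. (X l \<omega> - \<mu>) * (X l \<omega> - \<mu>)))"
    proof (intro sum.cong refl)
      fix l assume "l \<in> {..<J}"
      then have "(\<Sum>k<J. expectation (\<lambda>\<omega>. (X l \<omega> - \<mu>) * (X k \<omega> - \<mu>)))
          = (\<Sum>k\<in>{l}. expectation (\<lambda>\<omega>. (X l \<omega> - \<mu>) * (X k \<omega> - \<mu>)))"
        using uncorrelated(1) by (intro sum.mono_neutral_right) auto
      then show "(\<Sum>k<J. expectation (\<lambda>\<omega>. (X l \<omega> - \<mu>) * (X k \<omega> - \<mu>)))
          = expectation (\<lambda>\<omega>. (X l \<omega> - \<mu>) * (X l \<omega> - \<mu>))" by simp
    qed
    also have "(1 / real J)\<^sup>2 * \<dots> \<le> (1 / real J)\<^sup>2 * (real J * c)"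
      using sum_bounded_above[of "{..<J}" "\<lambda>l. expectation (\<lambda>\<omega>. (X l \<omega> - \<mu>) * (X l \<omega> - \<mu>))" c] var
      by (intro mult_left_mono) auto
    also have "\<dots> = c * (1 / real J)" using J by (simp add: power2_eq_square)
    finally show ?thesis .
  qed
  show "(\<lambda>J. expectation (\<lambda>\<omega>. ((1 / real J) * (\<Sum>l<J. X l \<omega>) - \<mu>)\<^sup>2)) \<longlonglongrightarrow> 0"
  proof (rule tendsto_sandwich[where f = "\<lambda>_. 0" and h = "\<lambda>J. c * (1 / real J)"])
    show "(\<lambda>J. c * (1 / real J)) \<longlonglongrightarrow> 0"
      by (rule tendsto_eq_intros lim_1_over_n | simp)+
    show "\<forall>\<^sub>F J in sequentially. expectation (\<lambda>\<omega>. ((1 / real J) * (\<Sum>l<J. X l \<omega>) - \<mu>)\<^sup>2) \<le> c * (1 / real J)"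
      using eventually_gt_at_top[of 0] by eventually_elim (rule le)
  qed auto
qed

text \<open>Working along subsequences replaces a measurable choice of the random threshold for \<open>u J\<close>
  below which \<open>E J\<close> occurs.\<close>
lemma (in prob_space) tendsto_prob_1_of_L1:
  fixes u :: "nat \<Rightarrow> 'a \<Rightarrow> real"
  assumes int: "\<And>J. integrable M (u J)"
    and lim: "(\<lambda>J. expectation (\<lambda>\<omega>. norm (u J \<omega>))) \<longlonglongrightarrow> 0"
    and E: "\<And>J. E J \<in> events"
    and ae: "AE \<omega> in M. \<forall>r. strict_mono r \<longrightarrow> (\<lambda>k. u (r k) \<omega>) \<longlonglongrightarrow> 0 \<longrightarrow>
        (\<forall>\<^sub>F k in sequentially. \<omega> \<in> E (r k))"
  shows "(\<lambda>J. prob (E J)) \<longlonglongrightarrow> 1"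
proof (rule ccontr)
  assume "\<not> ?thesis"
  then obtain e where e: "e > 0" "\<And>N. \<exists>J\<ge>N. e \<le> dist (prob (E J)) 1"
    by (auto simp: lim_sequentially not_less)
  then have inf: "infinite {J. e \<le> dist (prob (E J)) 1}"
    by (auto simp: infinite_nat_iff_unbounded_le)
  define r where "r = enumerate {J. e \<le> dist (prob (E J)) 1}"
  have r: "strict_mono r" "\<And>k. e \<le> dist (prob (E (r k))) 1"
    using strict_mono_enumerate[OF inf] enumerate_in_set[OF inf] by (auto simp: r_def)
  have "(\<lambda>k. expectation (\<lambda>\<omega>. norm (u (r k) \<omega>))) \<longlonglongrightarrow> 0"
    using LIMSEQ_subseq_LIMSEQ[OF lim r(1)] by (simp add: comp_def)
  \<comment> \<open>Convergence in mean gives almost sure convergence only along a further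
    subsequence, so hypothesis \<open>ae\<close> is applied to \<open>r \<circ> s\<close>.\<close>
  then obtain s where s: "strict_mono s" "AE \<omega> in M. (\<lambda>k. u (r (s k)) \<omega>) \<longlonglongrightarrow> 0"
    using tendsto_L1_AE_subseq[of M "\<lambda>k. u (r k)"] int by auto
  have rs: "strict_mono (r \<circ> s)" using r(1) s(1) by (rule strict_mono_o)
  from ae s(2) have "AE \<omega> in M. (\<lambda>k. indicator (E (r (s k))) \<omega> :: real) \<longlonglongrightarrow> 1"
  proof (eventually_elim)
    case (elim \<omega>)
    then have "\<forall>\<^sub>F k in sequentially. \<omega> \<in> E (r (s k))"
      using rs by (auto dest!: spec[of _ "r \<circ> s"] simp: comp_def)
    then have "\<forall>\<^sub>F k in sequentially. indicator (E (r (s k))) \<omega> = (1 :: real)"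
      by eventually_elim simp
    then show ?case by (rule tendsto_eventually)
  qed
  then have "(\<lambda>k. expectation (indicator (E (r (s k))))) \<longlonglongrightarrow> expectation (\<lambda>_. 1 :: real)"
    using E by (intro integral_dominated_convergence[where w = "\<lambda>_. 1"]) (auto simp: indicator_def)
  then have "(\<lambda>k. prob (E (r (s k)))) \<longlonglongrightarrow> 1"
    using E by (simp add: prob_space)
  then have "\<forall>\<^sub>F k in sequentially. dist (prob (E (r (s k)))) 1 < e"
    using e(1) by (rule tendstoD)
  then show False
    using r(2) by (auto simp: eventually_sequentially not_less[symmetric])
qed

section \<open>The ensemble\<close>

text \<open>Signals and measurements are omitted, being determined by \<open>zC\<close>,
  \<open>z\<close> and \<open>\<Phi>\<close>. Independence is stated in two layers: the entries
  within each row, and the family of all innovations (\<open>Inl\<close>) and whole rows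
  (\<open>Inr\<close>).\<close>

locale jsm3_ensemble = prob_space P for P :: "'w measure" +
  fixes zC :: "real^'n"
    and z :: "nat \<Rightarrow> 'w \<Rightarrow> real^'n"
    and \<Phi> :: "nat \<Rightarrow> 'w \<Rightarrow> nat \<Rightarrow> real^'n"
    and K M :: "nat \<Rightarrow> nat"
    and \<sigma> :: "nat \<Rightarrow> real"
    and \<tau> :: real
  assumes sparsity: "\<And>j. K j < CARD('n)"
    and rows: "\<And>j. M j \<ge> K j + 1"
    and sigma: "\<And>j. \<sigma> j > 0"
    and tau: "\<tau> > 0"
    and innovations: "\<And>j. distr P borel (z j) = innovation_law (K j) \<tau>"
    and entries_normal:
      "\<And>j i n. i < M j \<Longrightarrow> distributed P lborel (\<lambda>\<omega>. \<Phi> j \<omega> i $ n) (normal_density 0 (\<sigma> j))"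
    and entries_indep:
      "\<And>j i. i < M j \<Longrightarrow> indep_vars (\<lambda>_. borel) (\<lambda>n \<omega>. \<Phi> j \<omega> i $ n) UNIV"
    and rows_innovations_indep:
      "indep_vars (\<lambda>_. borel) (case_sum z (\<lambda>(j, i) \<omega>. \<Phi> j \<omega> i)) (UNIV <+> {(j, i). i < M j})"
begin

section \<open>Measurability and independence of rows and innovations\<close>

lemma measurable_innovation [measurable]: "z j \<in> borel_measurable P"
proof -
  have "random_variable borel (case_sum z (\<lambda>(j, i) \<omega>. \<Phi> j \<omega> i) (Inl j))"
    using rows_innovations_indep unfolding indep_vars_def by blast
  then show ?thesis by simp
qed

lemma measurable_row [measurable (raw)]:
  assumes "i < M j" shows "(\<lambda>\<omega>. \<Phi> j \<omega> i) \<in> borel_measurable P"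
proof -
  have "random_variable borel (case_sum z (\<lambda>(j, i) \<omega>. \<Phi> j \<omega> i) (Inr (j, i)))"
    using rows_innovations_indep assms unfolding indep_vars_def by blast
  then show ?thesis by simp
qed

lemma indep_row_innovation:
  assumes i: "i < M j"
    and f: "f \<in> borel_measurable borel" and g: "g \<in> borel_measurable borel"
  shows "indep_var borel (\<lambda>\<omega>. f (\<Phi> j \<omega> i)) borel (\<lambda>\<omega>. g (z j \<omega>))"
  using indep_vars_imp_indep_var_comp[OF rows_innovations_indep, of "Inr (j, i)" "Inl j" f borel g borel] assms
  by auto

section \<open>Moments and independence of the backprojections\<close>

lemma innovation_moments:
  shows "integrable P (\<lambda>\<omega>. (z j \<omega> $ n)\<^sup>2)" "expectation (\<lambda>\<omega>. (z j \<omega> $ n)\<^sup>2) \<le> \<tau>\<^sup>2"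
    "integrable P (\<lambda>\<omega>. z j \<omega> $ n)" "expectation (\<lambda>\<omega>. z j \<omega> $ n) = 0"
proof -
  note mom = innovation_law_moments[OF tau, of "K j" n, folded innovations]
  show sq: "integrable P (\<lambda>\<omega>. (z j \<omega> $ n)\<^sup>2)"
    using mom(1) by (subst (asm) integrable_distr_eq) auto
  show "expectation (\<lambda>\<omega>. (z j \<omega> $ n)\<^sup>2) \<le> \<tau>\<^sup>2"
    using mom(2) by (subst (asm) integral_distr) auto
  show "expectation (\<lambda>\<omega>. z j \<omega> $ n) = 0"
    using mom(3) by (subst (asm) integral_distr) auto
  show "integrable P (\<lambda>\<omega>. z j \<omega> $ n)"
    by (rule square_integrable_imp_integrable[OF _ sq]) measurable
qed

text \<open>Off-diagonal products have mean 0 by independence, so each row contributes a multiple of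
  the identity on average. Bounding the squared product by the mean of the two fourth powers treats
  equal and distinct indices alike.\<close>

lemma entry_product_moments:
  assumes i: "i < M j"
  shows "integrable P (\<lambda>\<omega>. \<Phi> j \<omega> i $ k * \<Phi> j \<omega> i $ n)"
    and "expectation (\<lambda>\<omega>. \<Phi> j \<omega> i $ k * \<Phi> j \<omega> i $ n) = (if k = n then (\<sigma> j)\<^sup>2 else 0)"
    and "integrable P (\<lambda>\<omega>. (\<Phi> j \<omega> i $ k * \<Phi> j \<omega> i $ n)\<^sup>2)"
    and "expectation (\<lambda>\<omega>. (\<Phi> j \<omega> i $ k * \<Phi> j \<omega> i $ n)\<^sup>2) \<le> 3 * \<sigma> j ^ 4"
proof -
  note [measurable] = measurable_row[OF i]
  note mom = normal_distributed_moments[OF entries_normal[OF i] sigma]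
  have le: "(\<Phi> j \<omega> i $ k * \<Phi> j \<omega> i $ n)\<^sup>2 \<le> (\<Phi> j \<omega> i $ k ^ 4 + \<Phi> j \<omega> i $ n ^ 4) / 2" for \<omega>
    using sum_squares_bound[of "(\<Phi> j \<omega> i $ k)\<^sup>2" "(\<Phi> j \<omega> i $ n)\<^sup>2"]
    by (simp add: power_mult_distrib flip: power_mult)
  have int: "integrable P (\<lambda>\<omega>. (\<Phi> j \<omega> i $ k ^ 4 + \<Phi> j \<omega> i $ n ^ 4) / 2)"
    using mom(1) by simp
  show sq: "integrable P (\<lambda>\<omega>. (\<Phi> j \<omega> i $ k * \<Phi> j \<omega> i $ n)\<^sup>2)"
  proof (rule Bochner_Integration.integrable_bound[OF int])
    show "(\<lambda>\<omega>. (\<Phi> j \<omega> i $ k * \<Phi> j \<omega> i $ n)\<^sup>2) \<in> borel_measurable P" by measurable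
    show "AE \<omega> in P. norm ((\<Phi> j \<omega> i $ k * \<Phi> j \<omega> i $ n)\<^sup>2)
        \<le> norm ((\<Phi> j \<omega> i $ k ^ 4 + \<Phi> j \<omega> i $ n ^ 4) / 2)"
      using le by (intro AE_I2) (simp add: zero_le_even_power)
  qed
  show "integrable P (\<lambda>\<omega>. \<Phi> j \<omega> i $ k * \<Phi> j \<omega> i $ n)"
    by (rule square_integrable_imp_integrable[OF _ sq]) measurable
  have "expectation (\<lambda>\<omega>. (\<Phi> j \<omega> i $ k * \<Phi> j \<omega> i $ n)\<^sup>2)
      \<le> expectation (\<lambda>\<omega>. (\<Phi> j \<omega> i $ k ^ 4 + \<Phi> j \<omega> i $ n ^ 4) / 2)"
    by (rule integral_mono[OF sq int le])
  also have "\<dots> = 3 * \<sigma> j ^ 4"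
    using mom(1,4) by simp
  finally show "expectation (\<lambda>\<omega>. (\<Phi> j \<omega> i $ k * \<Phi> j \<omega> i $ n)\<^sup>2) \<le> 3 * \<sigma> j ^ 4" .
  show "expectation (\<lambda>\<omega>. \<Phi> j \<omega> i $ k * \<Phi> j \<omega> i $ n) = (if k = n then (\<sigma> j)\<^sup>2 else 0)"
  proof (cases "k = n")
    case True
    then show ?thesis using mom(3)[of n] by (simp add: power2_eq_square)
  next
    case False
    have "indep_var borel (\<lambda>\<omega>. \<Phi> j \<omega> i $ k) borel (\<lambda>\<omega>. \<Phi> j \<omega> i $ n)"
      using indep_vars_imp_indep_var_comp[OF entries_indep[OF i], of k n "\<lambda>x. x" borel "\<lambda>x. x" borel] False
      by simp
    from indep_var_lebesgue_integral[OF this] show ?thesis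
      using mom(1)[of _ 1] mom(2) False by simp
  qed
qed

text \<open>This is the summand of signal \<open>j\<close> in the estimate of the common component,
  with the measurements written out.\<close>

definition backprojection :: "nat \<Rightarrow> 'w \<Rightarrow> real^'n" where
  "backprojection j \<omega> = (1 / (real (M j) * (\<sigma> j)\<^sup>2)) *\<^sub>R
     (\<Sum>i<M j. (\<Phi> j \<omega> i \<bullet> (zC + z j \<omega>)) *\<^sub>R \<Phi> j \<omega> i)"

text \<open>Expanding the inner product separates each term into \<open>a k\<close>, formed from the
  row, and \<open>b k\<close>, formed from the independent innovation. Expectations factor, and only
  \<open>k = n\<close> contributes to the mean.\<close>

lemma row_backprojection_moments:
  fixes n :: 'n
  assumes i: "i < M j"
  defines "t \<equiv> \<lambda>\<omega>. (\<Phi> j \<omega> i \<bullet> (zC + z j \<omega>)) * \<Phi> j \<omega> i $ n"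
  shows "expectation t = (\<sigma> j)\<^sup>2 * zC $ n"
    and "integrable P (\<lambda>\<omega>. (t \<omega>)\<^sup>2)"
    and "expectation (\<lambda>\<omega>. (t \<omega>)\<^sup>2) \<le> (real CARD('n))\<^sup>2 * (3 * \<sigma> j ^ 4 * (2 * ((norm zC)\<^sup>2 + \<tau>\<^sup>2)))"
proof -
  note [measurable] = measurable_row[OF i]
  define a where "a k \<omega> = \<Phi> j \<omega> i $ k * \<Phi> j \<omega> i $ n" for k \<omega>
  define b where "b k \<omega> = zC $ k + z j \<omega> $ k" for k \<omega>
  have [measurable]: "a k \<in> borel_measurable P" "b k \<in> borel_measurable P" for k
    unfolding a_def b_def by measurable
  have t: "t = (\<lambda>\<omega>. \<Sum>k\<in>UNIV. a k \<omega> * b k \<omega>)"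
    unfolding t_def a_def b_def inner_vec_def by (simp add: sum_distrib_left ac_simps fun_eq_iff)
  have a: "integrable P (a k)" "expectation (a k) = (if k = n then (\<sigma> j)\<^sup>2 else 0)"
    "integrable P (\<lambda>\<omega>. (a k \<omega>)\<^sup>2)" "expectation (\<lambda>\<omega>. (a k \<omega>)\<^sup>2) \<le> 3 * \<sigma> j ^ 4" for k
    unfolding a_def using entry_product_moments[OF i] by auto
  have b: "integrable P (b k)" "expectation (b k) = zC $ k" for k
    unfolding b_def using innovation_moments by (simp_all add: prob_space)
  have b_sq_le: "(b k \<omega>)\<^sup>2 \<le> 2 * (zC $ k)\<^sup>2 + 2 * (z j \<omega> $ k)\<^sup>2" for k \<omega>
    unfolding b_def using sum_squares_bound[of "zC $ k" "z j \<omega> $ k"] by (simp add: power2_sum)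
  have b_sq_int: "integrable P (\<lambda>\<omega>. 2 * (zC $ k)\<^sup>2 + 2 * (z j \<omega> $ k)\<^sup>2)" for k
    using innovation_moments(1) by simp
  have b2: "integrable P (\<lambda>\<omega>. (b k \<omega>)\<^sup>2)" for k
    by (rule Bochner_Integration.integrable_bound[OF b_sq_int[of k]]) (use b_sq_le in \<open>auto intro!: AE_I2\<close>)
  have b3: "expectation (\<lambda>\<omega>. (b k \<omega>)\<^sup>2) \<le> 2 * ((norm zC)\<^sup>2 + \<tau>\<^sup>2)" for k
  proof -
    have "expectation (\<lambda>\<omega>. (b k \<omega>)\<^sup>2) \<le> expectation (\<lambda>\<omega>. 2 * (zC $ k)\<^sup>2 + 2 * (z j \<omega> $ k)\<^sup>2)"
      by (rule integral_mono[OF b2 b_sq_int b_sq_le])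
    also have "\<dots> = 2 * (zC $ k)\<^sup>2 + 2 * expectation (\<lambda>\<omega>. (z j \<omega> $ k)\<^sup>2)"
      using innovation_moments(1) by (simp add: prob_space)
    also have "(zC $ k)\<^sup>2 \<le> (norm zC)\<^sup>2"
      using component_le_norm_cart[of zC k] by (metis abs_le_square_iff abs_norm_cancel)
    finally show ?thesis using innovation_moments(2)[of j k] by simp
  qed
  have ind: "indep_var borel (a k) borel (b k)" for k
    unfolding a_def b_def
    by (rule indep_row_innovation[OF i, where f = "\<lambda>v. v $ k * v $ n" and g = "\<lambda>v. zC $ k + v $ k"]) measurable
  have ind_sq: "indep_var borel (\<lambda>\<omega>. (a k \<omega>)\<^sup>2) borel (\<lambda>\<omega>. (b k \<omega>)\<^sup>2)" for k
    unfolding a_def b_def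
    by (rule indep_row_innovation[OF i, where f = "\<lambda>v. (v $ k * v $ n)\<^sup>2" and g = "\<lambda>v. (zC $ k + v $ k)\<^sup>2"]) measurable
  have "expectation t = (\<Sum>k\<in>UNIV. expectation (a k) * expectation (b k))"
    unfolding t using indep_var_lebesgue_integral[OF ind a(1) b(1)] indep_var_integrable[OF ind a(1) b(1)]
    by (simp add: Bochner_Integration.integral_sum)
  also have "\<dots> = (\<Sum>k\<in>UNIV. if k = n then (\<sigma> j)\<^sup>2 * zC $ k else 0)"
    unfolding a b by (intro sum.cong) auto
  finally show "expectation t = (\<sigma> j)\<^sup>2 * zC $ n" by simp
  have int: "integrable P (\<lambda>\<omega>. (a k \<omega> * b k \<omega>)\<^sup>2)" for k
    unfolding power_mult_distrib by (rule indep_var_integrable[OF ind_sq a(3) b2])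
  have le: "expectation (\<lambda>\<omega>. (a k \<omega> * b k \<omega>)\<^sup>2) \<le> 3 * \<sigma> j ^ 4 * (2 * ((norm zC)\<^sup>2 + \<tau>\<^sup>2))" for k
    unfolding power_mult_distrib indep_var_lebesgue_integral[OF ind_sq a(3) b2]
    using a(4) b3 by (intro mult_mono) auto
  show "integrable P (\<lambda>\<omega>. (t \<omega>)\<^sup>2)"
    unfolding t by (rule sum_square_moment_le(1)[OF _ _ int le]) auto
  show "expectation (\<lambda>\<omega>. (t \<omega>)\<^sup>2) \<le> (real CARD('n))\<^sup>2 * (3 * \<sigma> j ^ 4 * (2 * ((norm zC)\<^sup>2 + \<tau>\<^sup>2)))"
    unfolding t by (rule sum_square_moment_le(2)[OF _ _ int le]) auto
qed

text \<open>The normalisation makes the estimate unbiased. In the second moment it cancels the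
  factors \<open>(M j)\<^sup>2\<close> and \<open>\<sigma> j ^ 4\<close>, so the bound is uniform in
  \<open>j\<close>, as the weak law demands.\<close>

lemma backprojection_moments:
  shows "expectation (\<lambda>\<omega>. backprojection j \<omega> $ n) = zC $ n"
    and "integrable P (\<lambda>\<omega>. (backprojection j \<omega> $ n)\<^sup>2)"
    and "expectation (\<lambda>\<omega>. (backprojection j \<omega> $ n)\<^sup>2) \<le> 6 * (real CARD('n))\<^sup>2 * ((norm zC)\<^sup>2 + \<tau>\<^sup>2)"
proof -
  define t where "t i \<omega> = (\<Phi> j \<omega> i \<bullet> (zC + z j \<omega>)) * \<Phi> j \<omega> i $ n" for i \<omega>
  define s where "s = 1 / (real (M j) * (\<sigma> j)\<^sup>2)"
  have M: "M j > 0" using rows[of j] by simp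
  have [measurable]: "t i \<in> borel_measurable P" if "i < M j" for i
    unfolding t_def using measurable_row[OF that] by measurable
  have eq: "backprojection j \<omega> $ n = s * (\<Sum>i<M j. t i \<omega>)" for \<omega>
    by (simp add: backprojection_def s_def t_def)
  note mom = row_backprojection_moments[where j = j and n = n, folded t_def]
  have int: "integrable P (t i)" if "i < M j" for i
    using that by (intro square_integrable_imp_integrable[OF _ mom(2)]) auto
  have "expectation (\<lambda>\<omega>. backprojection j \<omega> $ n) = s * (\<Sum>i<M j. expectation (t i))"
    unfolding eq using int by (simp add: Bochner_Integration.integral_sum)
  also have "\<dots> = s * (real (M j) * ((\<sigma> j)\<^sup>2 * zC $ n))"
    using mom(1) by simp
  finally show "expectation (\<lambda>\<omega>. backprojection j \<omega> $ n) = zC $ n"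
    using M sigma[of j] by (simp add: s_def)
  show "integrable P (\<lambda>\<omega>. (backprojection j \<omega> $ n)\<^sup>2)"
    unfolding eq power_mult_distrib
    by (intro integrable_mult_right sum_square_moment_le(1)[OF _ _ mom(2,3)]) auto
  have "expectation (\<lambda>\<omega>. (backprojection j \<omega> $ n)\<^sup>2) = s\<^sup>2 * expectation (\<lambda>\<omega>. (\<Sum>i<M j. t i \<omega>)\<^sup>2)"
    unfolding eq power_mult_distrib by simp
  also have "\<dots> \<le> s\<^sup>2 * ((real (card {..<M j}))\<^sup>2 *
      ((real CARD('n))\<^sup>2 * (3 * \<sigma> j ^ 4 * (2 * ((norm zC)\<^sup>2 + \<tau>\<^sup>2)))))"
    by (intro mult_left_mono sum_square_moment_le(2)[OF _ _ mom(2,3)]) auto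
  also have "\<dots> = 6 * (real CARD('n))\<^sup>2 * ((norm zC)\<^sup>2 + \<tau>\<^sup>2)"
    using M sigma[of j] by (simp add: s_def power_mult_distrib power_divide field_simps flip: power_mult)
  finally show "expectation (\<lambda>\<omega>. (backprojection j \<omega> $ n)\<^sup>2) \<le> 6 * (real CARD('n))\<^sup>2 * ((norm zC)\<^sup>2 + \<tau>\<^sup>2)" .
qed

text \<open>Each backprojection depends only on the block \<open>B j\<close> of its own innovation
  and rows, and these blocks are disjoint.\<close>

lemma indep_backprojections: "indep_vars (\<lambda>_. borel) (\<lambda>j \<omega>. backprojection j \<omega> $ n) UNIV"
proof -
  define X where "X = case_sum z (\<lambda>(j, i) \<omega>. \<Phi> j \<omega> i)"
  define B where "B j = insert (Inl j) (Inr ` Pair j ` {..<M j})" for j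
  define F where "F j A = ((1 / (real (M j) * (\<sigma> j)\<^sup>2)) *\<^sub>R
     (\<Sum>i<M j. (A (Inr (j, i)) \<bullet> (zC + A (Inl j))) *\<^sub>R A (Inr (j, i)))) $ n"
    for j and A :: "nat + nat \<times> nat \<Rightarrow> real^'n"
  have "indep_vars (\<lambda>j. PiM (B j) (\<lambda>_. borel)) (\<lambda>j \<omega>. restrict (\<lambda>i. X i \<omega>) (B j)) UNIV"
    by (rule indep_vars_restrict[OF rows_innovations_indep[folded X_def]])
       (auto simp: B_def disjoint_family_on_def)
  moreover have "F j \<in> borel_measurable (PiM (B j) (\<lambda>_. borel))" for j
  proof -
    have [measurable]: "(\<lambda>A. A (Inl j)) \<in> borel_measurable (PiM (B j) (\<lambda>_. borel))"
      "i < M j \<Longrightarrow> (\<lambda>A. A (Inr (j, i))) \<in> borel_measurable (PiM (B j) (\<lambda>_. borel))" for i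
      by (intro measurable_component_singleton; simp add: B_def)+
    show ?thesis unfolding F_def by measurable
  qed
  ultimately have "indep_vars (\<lambda>_. borel) (\<lambda>j \<omega>. F j (restrict (\<lambda>i. X i \<omega>) (B j))) UNIV"
    by (rule indep_vars_compose2)
  moreover have "F j (restrict (\<lambda>i. X i \<omega>) (B j)) = backprojection j \<omega> $ n" for j \<omega>
    unfolding F_def backprojection_def by (simp add: B_def X_def)
  ultimately show ?thesis by simp
qed

lemma measurable_backprojection [measurable]: "backprojection j \<in> borel_measurable P"
  unfolding backprojection_def by measurable

text \<open>The squared norm is a finite sum over coordinates, and the weak law applies to each of
  them.\<close>

lemma mean_backprojection_L2_convergence:
  shows "integrable P (\<lambda>\<omega>. (norm ((1 / real J) *\<^sub>R (\<Sum>j<J. backprojection j \<omega>) - zC))\<^sup>2)"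
    and "(\<lambda>J. expectation (\<lambda>\<omega>. (norm ((1 / real J) *\<^sub>R (\<Sum>j<J. backprojection j \<omega>) - zC))\<^sup>2)) \<longlonglongrightarrow> 0"
proof -
  have eq: "(norm ((1 / real J) *\<^sub>R (\<Sum>j<J. backprojection j \<omega>) - zC))\<^sup>2
      = (\<Sum>n\<in>UNIV. ((1 / real J) * (\<Sum>j<J. backprojection j \<omega> $ n) - zC $ n)\<^sup>2)" for J \<omega>
    unfolding norm_vec_def L2_set_def by (simp add: sum_nonneg)
  note wl = L2_weak_law[OF indep_backprojections backprojection_moments(2,1,3)]
  show "integrable P (\<lambda>\<omega>. (norm ((1 / real J) *\<^sub>R (\<Sum>j<J. backprojection j \<omega>) - zC))\<^sup>2)"
    unfolding eq by (intro Bochner_Integration.integrable_sum wl(1))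
  have "(\<lambda>J. \<Sum>n\<in>UNIV. expectation (\<lambda>\<omega>. ((1 / real J) * (\<Sum>j<J. backprojection j \<omega> $ n) - zC $ n)\<^sup>2))
      \<longlonglongrightarrow> (\<Sum>n\<in>(UNIV :: 'n set). 0)"
    by (intro tendsto_sum wl(2))
  then show "(\<lambda>J. expectation (\<lambda>\<omega>. (norm ((1 / real J) *\<^sub>R (\<Sum>j<J. backprojection j \<omega>) - zC))\<^sup>2)) \<longlonglongrightarrow> 0"
    unfolding eq using wl(1) by (simp add: Bochner_Integration.integral_sum del: of_nat_sum)
qed

section \<open>Almost sure identifiability of an innovation\<close>

lemma AE_row_inner_nonzero:
  assumes "i < M j" "w \<noteq> 0"
  shows "AE a in distr P borel (\<lambda>\<omega>. \<Phi> j \<omega> i). a \<bullet> w \<noteq> 0"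
  using AE_normal_entries_inner_nonzero[OF entries_normal[OF assms(1)] sigma entries_indep[OF assms(1)] assms(2)]
    measurable_row[OF assms(1)]
  by (subst AE_distr_iff) auto

lemma AE_card_support_innovation: "AE \<omega> in P. card (support (z j \<omega>)) = K j"
  using AE_innovation_law_card_support[OF tau, of "K j", where 'n = 'n] sparsity[of j]
  unfolding innovations[symmetric] by (intro AE_distrD[OF measurable_innovation]) simp

text \<open>With the innovation fixed first, all subspaces in \<open>identifiableI\<close> are
  deterministic and finitely many, of dimension at most \<open>K j + 1\<close>. The independent
  rows, at least that many, are injective on each of them almost surely.\<close>

lemma AE_identifiable: "AE \<omega> in P. identifiable (M j) (\<Phi> j \<omega>) (z j \<omega>)"
proof -
  define X where "X = case_sum z (\<lambda>(j, i) \<omega>. \<Phi> j \<omega> i)"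
  define I where "I = (Inr ` Pair j ` {..<M j} :: (nat + nat \<times> nat) set)"
  define k where "k = (Inl j :: nat + nat \<times> nat)"
  define \<nu> where "\<nu> b = distr P borel (X b)" for b
  define Q where "Q A \<longleftrightarrow> identifiable (M j) (\<lambda>i. A (Inr (j, i))) (A k)" for A :: "nat + nat \<times> nat \<Rightarrow> real^'n"
  have rv: "X b \<in> borel_measurable P" if "b \<in> insert k I" for b
    using that by (auto simp: X_def k_def I_def)
  have prob: "prob_space (\<nu> b)" if "b \<in> insert k I" for b
    unfolding \<nu>_def using rv[OF that] by (rule prob_space_distr)
  have sets: "sets (\<nu> b) = sets borel" for b by (simp add: \<nu>_def)
  have "indep_vars (\<lambda>_. borel) X (insert k I)"
    using rows_innovations_indep unfolding X_def by (rule indep_vars_subset) (auto simp: I_def k_def)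
  \<comment> \<open>Independence makes the joint law a product, so \<open>AE_PiM_insertI\<close> can
    freeze the innovation coordinate \<open>k\<close>.\<close>
  then have joint: "distr P (PiM (insert k I) (\<lambda>_. borel)) (\<lambda>\<omega>. \<lambda>b\<in>insert k I. X b \<omega>) = PiM (insert k I) \<nu>"
    using rv unfolding \<nu>_def by (subst (asm) indep_vars_iff_distr_eq_PiM') auto
  have Q_pred: "Measurable.pred (PiM (insert k I) (\<lambda>_. borel)) Q"
    unfolding Q_def
    by (intro pred_identifiable measurable_component_singleton) (auto simp: I_def k_def)
  have sets_eq: "sets (PiM (insert k I) \<nu>) = sets (PiM (insert k I) (\<lambda>_. borel))"
    by (intro sets_PiM_cong refl sets)
  have card_I: "card I = M j"
    unfolding I_def by (simp add: card_image inj_on_def)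
  have "AE A in PiM (insert k I) \<nu>. Q A"
  proof (rule AE_PiM_insertI[OF prob])
    show "Measurable.pred (PiM (insert k I) \<nu>) Q"
      using Q_pred measurable_cong_sets[OF sets_eq refl] by blast
    have nu_k: "\<nu> k = innovation_law (K j) \<tau>"
      unfolding \<nu>_def X_def k_def using innovations by simp
    have "AE x in \<nu> k. card (support x) = K j"
      unfolding nu_k by (rule AE_innovation_law_card_support[OF tau less_imp_le[OF sparsity]])
    then show "AE x in \<nu> k. AE A in PiM I \<nu>. Q (A(k := x))"
    proof eventually_elim
      case (elim x)
      have inj: "AE A in PiM I \<nu>. \<forall>u\<in>U. (\<forall>b\<in>I. A b \<bullet> u = 0) \<longrightarrow> u = 0"
        if "subspace U" "dim U \<le> M j" for U
      proof (rule AE_injective_on_subspace)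
        show "AE a in \<nu> b. a \<bullet> w \<noteq> 0" if "b \<in> I" "w \<noteq> 0" for b w
        proof -
          obtain i where i: "b = Inr (j, i)" "i < M j" using \<open>b \<in> I\<close> by (auto simp: I_def)
          then have nu_b: "\<nu> b = distr P borel (\<lambda>\<omega>. \<Phi> j \<omega> i)" by (simp add: \<nu>_def X_def)
          show ?thesis unfolding nu_b by (rule AE_row_inner_nonzero[OF i(2) \<open>w \<noteq> 0\<close>])
        qed
      qed (use that prob sets card_I in \<open>auto simp: I_def\<close>)
      have "AE A in PiM I \<nu>. \<forall>u\<in>{v. support v \<subseteq> support x}. (\<forall>b\<in>I. A b \<bullet> u = 0) \<longrightarrow> u = 0"
        using rows[of j] elim by (intro inj subspace_support) (simp add: dim_support)
      moreover have "AE A in PiM I \<nu>. \<forall>T\<in>{T. card T = card (support x)}.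
          \<forall>u\<in>span (insert x {v. support v \<subseteq> T}). (\<forall>b\<in>I. A b \<bullet> u = 0) \<longrightarrow> u = 0"
      proof (rule AE_finite_allI)
        fix T :: "'n set" assume "T \<in> {T. card T = card (support x)}"
        then have "dim (span (insert x {v. support v \<subseteq> T})) \<le> M j"
          using rows[of j] elim by (simp add: dim_insert dim_support)
        then show "AE A in PiM I \<nu>. \<forall>u\<in>span (insert x {v. support v \<subseteq> T}). (\<forall>b\<in>I. A b \<bullet> u = 0) \<longrightarrow> u = 0"
          by (intro inj subspace_span)
      qed simp
      ultimately show ?case
      proof eventually_elim
        case (elim A)
        have I_iff: "(\<forall>b\<in>I. A b \<bullet> u = 0) \<longleftrightarrow> (\<forall>i<M j. A (Inr (j, i)) \<bullet> u = 0)" for u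
          by (auto simp: I_def)
        have "identifiable (M j) (\<lambda>i. A (Inr (j, i))) x"
        proof (rule identifiableI)
          show "v = 0" if "support v \<subseteq> support x" "\<forall>i<M j. A (Inr (j, i)) \<bullet> v = 0" for v
            using elim(1) that unfolding I_iff by simp
          show "u = 0" if "card T = card (support x)" "u \<in> span (insert x {v. support v \<subseteq> T})"
              "\<forall>i<M j. A (Inr (j, i)) \<bullet> u = 0" for T u
            using elim(2) that unfolding I_iff by simp
        qed
        then show ?case by (simp add: Q_def k_def)
      qed
    qed
  qed auto
  then have "AE A in distr P (PiM (insert k I) (\<lambda>_. borel)) (\<lambda>\<omega>. \<lambda>b\<in>insert k I. X b \<omega>). Q A"
    unfolding joint .
  then have "AE \<omega> in P. Q (\<lambda>b\<in>insert k I. X b \<omega>)"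
    by (rule AE_distrD[rotated]) (intro measurable_restrict rv)
  \<comment> \<open>The restricted family reproduces the rows of \<open>\<Phi> j \<omega>\<close>
    only below \<open>M j\<close>, hence the congruence rule.\<close>
  moreover have "Q (\<lambda>b\<in>insert k I. X b \<omega>) \<longleftrightarrow> identifiable (M j) (\<Phi> j \<omega>) (z j \<omega>)" for \<omega>
  proof -
    have "identifiable (M j) (\<lambda>i. (\<lambda>b\<in>insert k I. X b \<omega>) (Inr (j, i))) (z j \<omega>) \<longleftrightarrow>
        identifiable (M j) (\<Phi> j \<omega>) (z j \<omega>)"
      by (rule identifiable_cong) (simp add: X_def I_def)
    then show ?thesis by (simp add: Q_def X_def k_def)
  qed
  ultimately show ?thesis by simp
qed

text \<open>The error of the common component enters as the perturbation
  \<open>zC - zc J \<omega>\<close>. It tends to 0 in mean square, so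
  \<open>tendsto_prob_1_of_L1\<close> turns the deterministic stability result into a statement on
  probabilities.\<close>

lemma ls_l0_recovery_probability:
  fixes zc :: "nat \<Rightarrow> 'w \<Rightarrow> real^'n"
  assumes \<epsilon>: "\<epsilon> > 0"
  defines "zc \<equiv> \<lambda>J \<omega>. (1 / real J) *\<^sub>R (\<Sum>l<J. backprojection l \<omega>)"
  shows "(\<lambda>J. prob {\<omega> \<in> space P. \<forall>\<Omega> v.
            ls_l0_solution (M j) (\<Phi> j \<omega>) (\<lambda>i. \<Phi> j \<omega> i \<bullet> (z j \<omega> + (zC - zc J \<omega>))) (K j) \<Omega> v \<longrightarrow>
            \<Omega> = support (z j \<omega>) \<and> norm (zc J \<omega> - (zC + z j \<omega>) + v) < \<epsilon>}) \<longlonglongrightarrow> 1"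
proof (rule tendsto_prob_1_of_L1)
  have [measurable]: "zc J \<in> borel_measurable P" for J unfolding zc_def by measurable
  show "integrable P (\<lambda>\<omega>. (norm (zc J \<omega> - zC))\<^sup>2)" for J
    unfolding zc_def by (rule mean_backprojection_L2_convergence)
  show "(\<lambda>J. expectation (\<lambda>\<omega>. norm ((norm (zc J \<omega> - zC))\<^sup>2))) \<longlonglongrightarrow> 0"
    unfolding zc_def using mean_backprojection_L2_convergence(2) by simp
  show "{\<omega> \<in> space P. \<forall>\<Omega> v.
            ls_l0_solution (M j) (\<Phi> j \<omega>) (\<lambda>i. \<Phi> j \<omega> i \<bullet> (z j \<omega> + (zC - zc J \<omega>))) (K j) \<Omega> v \<longrightarrow>
            \<Omega> = support (z j \<omega>) \<and> norm (zc J \<omega> - (zC + z j \<omega>) + v) < \<epsilon>} \<in> events" for J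
    unfolding pred_def[symmetric] by (rule pred_ls_l0_correct) measurable
  show "AE \<omega> in P. \<forall>r. strict_mono r \<longrightarrow> (\<lambda>k. (norm (zc (r k) \<omega> - zC))\<^sup>2) \<longlonglongrightarrow> 0 \<longrightarrow>
      (\<forall>\<^sub>F k in sequentially. \<omega> \<in> {\<omega> \<in> space P. \<forall>\<Omega> v.
            ls_l0_solution (M j) (\<Phi> j \<omega>) (\<lambda>i. \<Phi> j \<omega> i \<bullet> (z j \<omega> + (zC - zc (r k) \<omega>))) (K j) \<Omega> v \<longrightarrow>
            \<Omega> = support (z j \<omega>) \<and> norm (zc (r k) \<omega> - (zC + z j \<omega>) + v) < \<epsilon>})"
    using AE_space AE_identifiable[of j] AE_card_support_innovation[of j]
  proof (eventually_elim, intro allI impI)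
    fix \<omega> and r :: "nat \<Rightarrow> nat"
    assume \<omega>: "\<omega> \<in> space P" and id: "identifiable (M j) (\<Phi> j \<omega>) (z j \<omega>)"
      and card: "card (support (z j \<omega>)) = K j"
      and lim: "(\<lambda>k. (norm (zc (r k) \<omega> - zC))\<^sup>2) \<longlonglongrightarrow> 0"
    have "(\<lambda>k. norm (zC - zc (r k) \<omega>)) \<longlonglongrightarrow> 0"
      using tendsto_real_sqrt[OF lim] by (simp add: norm_minus_commute)
    then have d: "(\<lambda>k. zC - zc (r k) \<omega>) \<longlonglongrightarrow> 0" by (rule tendsto_norm_zero_cancel)
    have "\<forall>\<^sub>F k in sequentially. norm (zC - zc (r k) \<omega>) < \<epsilon> / 2"
      using \<open>(\<lambda>k. norm (zC - zc (r k) \<omega>)) \<longlonglongrightarrow> 0\<close> \<epsilon> by (intro order_tendstoD(2)[of _ 0]) auto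
    moreover note ls_l0_eventually_correct[OF id d half_gt_zero[OF \<epsilon>], unfolded card]
    ultimately show "\<forall>\<^sub>F k in sequentially. \<omega> \<in> {\<omega> \<in> space P. \<forall>\<Omega> v.
            ls_l0_solution (M j) (\<Phi> j \<omega>) (\<lambda>i. \<Phi> j \<omega> i \<bullet> (z j \<omega> + (zC - zc (r k) \<omega>))) (K j) \<Omega> v \<longrightarrow>
            \<Omega> = support (z j \<omega>) \<and> norm (zc (r k) \<omega> - (zC + z j \<omega>) + v) < \<epsilon>}"
    proof eventually_elim
      case (elim k)
      \<comment> \<open>The two errors add up in the signal estimate: one half of
        \<open>\<epsilon>\<close> is for the common component, the other for the innovation.\<close>
      have "norm (zc (r k) \<omega> - (zC + z j \<omega>) + v) < \<epsilon>" if "norm (v - z j \<omega>) < \<epsilon> / 2" for v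
      proof -
        have "norm ((v - z j \<omega>) - (zC - zc (r k) \<omega>)) < \<epsilon>"
          using norm_triangle_ineq4[of "v - z j \<omega>" "zC - zc (r k) \<omega>"] that elim(1) by simp
        then show ?thesis by (simp add: algebra_simps)
      qed
      then show ?case using elim(2) \<omega> by blast
    qed
  qed
qed

end

text \<open>For finite \<open>J\<close> the estimate of the common component carries an error, so
  recovery means the exact support together with any prescribed accuracy. Quantifying over all
  outputs covers every way of breaking ties.\<close>

theorem theorem8:
  fixes P :: "'w measure"
    and zC :: "real^'n"
    and z x :: "nat \<Rightarrow> 'w \<Rightarrow> real^'n"
    and \<Phi> :: "nat \<Rightarrow> 'w \<Rightarrow> nat \<Rightarrow> real^'n"
    and y :: "nat \<Rightarrow> 'w \<Rightarrow> nat \<Rightarrow> real"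
    and K M :: "nat \<Rightarrow> nat"
    and \<sigma> :: "nat \<Rightarrow> real"
    and \<tau> \<epsilon> :: real
    and j :: nat
  assumes prob: "prob_space P"
    and sparsity: "\<And>j. K j < CARD('n)"
    and rows: "\<And>j. M j \<ge> K j + 1"
    and sigma: "\<And>j. \<sigma> j > 0"
    and tau: "\<tau> > 0"
    and innovations: "\<And>j. distr P borel (z j) = innovation_law (K j) \<tau>"
    and entries_normal:
      "\<And>j i n. i < M j \<Longrightarrow> distributed P lborel (\<lambda>\<omega>. \<Phi> j \<omega> i $ n) (normal_density 0 (\<sigma> j))"
    and entries_indep:
      "\<And>j i. i < M j \<Longrightarrow> prob_space.indep_vars P (\<lambda>_. borel) (\<lambda>n \<omega>. \<Phi> j \<omega> i $ n) UNIV"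
    and rows_innovations_indep:
      "prob_space.indep_vars P (\<lambda>_. borel) (case_sum z (\<lambda>(j, i) \<omega>. \<Phi> j \<omega> i))
         (UNIV <+> {(j, i). i < M j})"
    and signal: "\<And>j \<omega>. \<omega> \<in> space P \<Longrightarrow> x j \<omega> = zC + z j \<omega>"
    and measurements: "\<And>j \<omega> i. \<omega> \<in> space P \<Longrightarrow> i < M j \<Longrightarrow> y j \<omega> i = \<Phi> j \<omega> i \<bullet> x j \<omega>"
    and eps: "\<epsilon> > 0"
  shows "(\<lambda>J. measure P {\<omega> \<in> space P. \<forall>\<Omega> xhat.
            tecc_output K M \<sigma> (\<lambda>j. \<Phi> j \<omega>) (\<lambda>j. y j \<omega>) J j \<Omega> xhat \<longrightarrow>
            \<Omega> = support (z j \<omega>) \<and> norm (xhat - x j \<omega>) < \<epsilon>})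
         \<longlonglongrightarrow> 1"
proof -
  interpret jsm3_ensemble P zC z \<Phi> K M \<sigma> \<tau>
    by (intro jsm3_ensemble.intro jsm3_ensemble_axioms.intro) (fact assms)+
  define zc where "zc J \<omega> = (1 / real J) *\<^sub>R (\<Sum>l<J. backprojection l \<omega>)" for J \<omega>
  have common: "tecc_common M \<sigma> (\<lambda>j. \<Phi> j \<omega>) (\<lambda>j. y j \<omega>) J = zc J \<omega>" if "\<omega> \<in> space P" for J \<omega>
    using that unfolding tecc_common_def zc_def backprojection_def
    by (simp add: measurements signal)
  have "(\<forall>\<Omega> xhat. tecc_output K M \<sigma> (\<lambda>j. \<Phi> j \<omega>) (\<lambda>j. y j \<omega>) J j \<Omega> xhat \<longrightarrow>
            \<Omega> = support (z j \<omega>) \<and> norm (xhat - x j \<omega>) < \<epsilon>) \<longleftrightarrow>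
      (\<forall>\<Omega> v. ls_l0_solution (M j) (\<Phi> j \<omega>) (\<lambda>i. \<Phi> j \<omega> i \<bullet> (z j \<omega> + (zC - zc J \<omega>))) (K j) \<Omega> v \<longrightarrow>
            \<Omega> = support (z j \<omega>) \<and> norm (zc J \<omega> - (zC + z j \<omega>) + v) < \<epsilon>)"
    if \<omega>: "\<omega> \<in> space P" for J \<omega>
  proof -
    \<comment> \<open>Subtracting the estimated common part from \<open>y j\<close> leaves the
      measurements of the innovation plus the estimation error.\<close>
    have ls_eq: "ls_l0_solution (M j) (\<Phi> j \<omega>) (\<lambda>i. y j \<omega> i - \<Phi> j \<omega> i \<bullet> zc J \<omega>) (K j) \<Omega> v \<longleftrightarrow>
        ls_l0_solution (M j) (\<Phi> j \<omega>) (\<lambda>i. \<Phi> j \<omega> i \<bullet> (z j \<omega> + (zC - zc J \<omega>))) (K j) \<Omega> v" for \<Omega> v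
      using \<omega> by (intro ls_l0_solution_cong) (auto simp: measurements signal inner_simps)
    have norm_eq: "zc J \<omega> + v - x j \<omega> = zc J \<omega> - (zC + z j \<omega>) + v" for v
      using \<omega> by (simp add: signal)
    show ?thesis
      unfolding tecc_output_def Let_def common[OF \<omega>] ls_eq norm_eq[symmetric] by auto
  qed
  then show ?thesis
    using ls_l0_recovery_probability[OF eps, of j] unfolding zc_def[symmetric]
    by (simp cong: conj_cong)
qed

end
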